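(* Let $X$ be a $d$-dimensional $\lambda$-two-sided link expander, and let $\ell_1,\ell_2\ge0$ be integers with $\ell_1+\ell_2+1\le d$. Let $C^{\ell_1,\ell_2}$ be the bipartite operator of the $(\ell_1,\ell_2)$-complement walk. Then $$\lambda(C^{\ell_1,\ell_2})\le(\ell_1+1)(\ell_2+1)\lambda.$$
   Context: **Weighted simplicial complexes.** $X(k)$ denotes the faces of size $k+1$ of a $d$-dimensional complex $X$ (with $X(-1)=\{\emptyset\}$), weighted by a distribution on $X(d)$: choose a $d$-face, then a uniform chain of subfaces, which induces measures on each $X(k)$. The link of $s$ is $X_s=\{u\setminus s:s\subseteq u\in X\}$, with $\Pr_{X_s}[u]=\Pr[u\cup s\mid s]$. **Link expansion.** $X$ is a $\lambda$-two-sided link expander if for every $-1\le k\le d-2$ and $s\in X(k)$, the random-walk operator of the underlying graph of $X_s$ (vertices $X_s(0)$, edges $X_s(1)$, with link measures) has all eigenvalues except the top one in $[-\lambda,\lambda]$. **Complement walk.** The $(\ell_1,\ell_2)$-complement walk is the bipartite graph with $L=X(\ell_1)$, $R=X(\ell_2)$ and edges $(s,t)$ with $s\sqcup t\in X(\ell_1+\ell_2+1)$. An edge is chosen by choosing $u\in X(\ell_1+\ell_2+1)$ by the measure and then a uniformly random $s\subseteq u$ of size $\ell_1+1$, with $t=u\setminus s$. **Bipartite expansion.** For a bipartite graph with edge distribution, $L,R$ carry the marginal measures and $Bf(v)=\mathbb E_{w\sim v}f(w)$. Define $\lambda(B)=\sup\{\langle Bf,g\rangle:\|f\|=\|g\|=1,\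 f\perp\text{constants}\}$. *)

theory Defs
  imports Complex_Main
begin

text \<open>A d-dimensional weighted complex is given by a finite set F of top faces
(each of size d+1) together with a probability distribution w on F.
The complex X consists of all subsets of top faces of positive weight.\<close>

definition weighted_complex :: "'v set set \<Rightarrow> ('v set \<Rightarrow> real) \<Rightarrow> nat \<Rightarrow> bool" where
  "weighted_complex F w d \<longleftrightarrow> finite F \<and> (\<forall>u\<in>F. finite u \<and> card u = d + 1)
     \<and> (\<forall>u\<in>F. w u \<ge> 0) \<and> (\<Sum>u\<in>F. w u) = 1"

definition faces :: "'v set set \<Rightarrow> ('v set \<Rightarrow> real) \<Rightarrow> 'v set set" where
  "faces F w = {s. \<exists>u\<in>F. 0 < w u \<and> s \<subseteq> u}"

definition level :: "'v set set \<Rightarrow> ('v set \<Rightarrow> real) \<Rightarrow> nat \<Rightarrow> 'v set set" where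
  "level F w k = {s \<in> faces F w. card s = k + 1}"

text \<open>Induced measure: choose a top face by w, then a uniform subface of size |s|.\<close>
definition meas :: "'v set set \<Rightarrow> ('v set \<Rightarrow> real) \<Rightarrow> nat \<Rightarrow> 'v set \<Rightarrow> real" where
  "meas F w d s = (\<Sum>u\<in>{u\<in>F. s \<subseteq> u}. w u) / real ((d + 1) choose card s)"

definition link_F :: "'v set set \<Rightarrow> 'v set \<Rightarrow> 'v set set" where
  "link_F F s = {u - s | u. u \<in> F \<and> s \<subseteq> u}"

text \<open>Pr_{X_s}[t] = Pr[t \<union> s | s] on top faces of the link.\<close>
definition link_w :: "'v set set \<Rightarrow> ('v set \<Rightarrow> real) \<Rightarrow> 'v set \<Rightarrow> 'v set \<Rightarrow> real" where
  "link_w F w s t = (\<Sum>u\<in>{u\<in>F. s \<subseteq> u \<and> u - s = t}. w u) / (\<Sum>u\<in>{u\<in>F. s \<subseteq> u}. w u)"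

definition link_vertices :: "'v set set \<Rightarrow> ('v set \<Rightarrow> real) \<Rightarrow> 'v set \<Rightarrow> 'v set" where
  "link_vertices F w s = {v. {v} \<in> faces (link_F F s) (link_w F w s)}"

definition link_vmeas :: "'v set set \<Rightarrow> ('v set \<Rightarrow> real) \<Rightarrow> nat \<Rightarrow> 'v set \<Rightarrow> 'v \<Rightarrow> real" where
  "link_vmeas F w d s v = meas (link_F F s) (link_w F w s) (d - card s) {v}"

definition link_emeas :: "'v set set \<Rightarrow> ('v set \<Rightarrow> real) \<Rightarrow> nat \<Rightarrow> 'v set \<Rightarrow> 'v \<Rightarrow> 'v \<Rightarrow> real" where
  "link_emeas F w d s v x =
     (if v \<noteq> x then meas (link_F F s) (link_w F w s) (d - card s) {v, x} else 0)"

definition link_walk ::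
  "'v set set \<Rightarrow> ('v set \<Rightarrow> real) \<Rightarrow> nat \<Rightarrow> 'v set \<Rightarrow> ('v \<Rightarrow> real) \<Rightarrow> 'v \<Rightarrow> real" where
  "link_walk F w d s f v =
     (\<Sum>x\<in>link_vertices F w s. link_emeas F w d s v x * f x)
       / (\<Sum>x\<in>link_vertices F w s. link_emeas F w d s v x)"

text \<open>All eigenvalues of the walk except the top one (the constant eigenvector, eigenvalue 1)
lie in [-lam, lam]: the walk is self-adjoint for the vertex measure, so the remaining
eigenvalues are exactly the eigenvalues of its restriction to functions orthogonal to the
constants.\<close>
definition link_spectral_ok ::
  "'v set set \<Rightarrow> ('v set \<Rightarrow> real) \<Rightarrow> nat \<Rightarrow> 'v set \<Rightarrow> real \<Rightarrow> bool" where
  "link_spectral_ok F w d s lam \<longleftrightarrow>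
     (\<forall>mu (f :: 'v \<Rightarrow> real).
        (\<forall>v\<in>link_vertices F w s. link_walk F w d s f v = mu * f v)
        \<and> (\<exists>v\<in>link_vertices F w s. f v \<noteq> 0)
        \<and> (\<Sum>v\<in>link_vertices F w s. link_vmeas F w d s v * f v) = 0
        \<longrightarrow> -lam \<le> mu \<and> mu \<le> lam)"

text \<open>lam-two-sided link expander: for all -1 \<le> k \<le> d-2 and s \<in> X(k), i.e. all faces s
with |s| \<le> d-1 (including the empty face).\<close>
definition two_sided_link_expander ::
  "'v set set \<Rightarrow> ('v set \<Rightarrow> real) \<Rightarrow> nat \<Rightarrow> real \<Rightarrow> bool" where
  "two_sided_link_expander F w d lam \<longleftrightarrow>
     weighted_complex F w d \<and>
     (\<forall>s\<in>faces F w. card s \<le> d - 1 \<longrightarrow> link_spectral_ok F w d s lam)"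

definition margL :: "'a set \<Rightarrow> 'b set \<Rightarrow> ('a \<Rightarrow> 'b \<Rightarrow> real) \<Rightarrow> 'a \<Rightarrow> real" where
  "margL L R E v = (\<Sum>x\<in>R. E v x)"

definition margR :: "'a set \<Rightarrow> 'b set \<Rightarrow> ('a \<Rightarrow> 'b \<Rightarrow> real) \<Rightarrow> 'b \<Rightarrow> real" where
  "margR L R E x = (\<Sum>v\<in>L. E v x)"

definition bip_op :: "'a set \<Rightarrow> 'b set \<Rightarrow> ('a \<Rightarrow> 'b \<Rightarrow> real) \<Rightarrow> ('b \<Rightarrow> real) \<Rightarrow> 'a \<Rightarrow> real" where
  "bip_op L R E f v = (\<Sum>x\<in>R. E v x * f x) / margL L R E v"

definition bip_lambda :: "'a set \<Rightarrow> 'b set \<Rightarrow> ('a \<Rightarrow> 'b \<Rightarrow> real) \<Rightarrow> real" where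
  "bip_lambda L R E = Sup {(\<Sum>v\<in>L. margL L R E v * bip_op L R E f v * g v) | f g.
      sqrt (\<Sum>x\<in>R. margR L R E x * (f x)\<^sup>2) = 1
    \<and> sqrt (\<Sum>v\<in>L. margL L R E v * (g v)\<^sup>2) = 1
    \<and> (\<Sum>x\<in>R. margR L R E x * f x) = 0}"

text \<open>Choose u \<in> X(l1+l2+1) by its measure, then a uniform s \<subseteq> u of size l1+1, t = u - s.\<close>
definition complement_edge ::
  "'v set set \<Rightarrow> ('v set \<Rightarrow> real) \<Rightarrow> nat \<Rightarrow> nat \<Rightarrow> nat \<Rightarrow> 'v set \<Rightarrow> 'v set \<Rightarrow> real" where
  "complement_edge F w d l1 l2 s t =
     (if s \<inter> t = {} \<and> s \<union> t \<in> level F w (l1 + l2 + 1) \<and> card s = l1 + 1 \<and> card t = l2 + 1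
      then meas F w d (s \<union> t) / real ((l1 + l2 + 2) choose (l1 + 1)) else 0)"

end

theory Submission
  imports Defs "HOL-Analysis.Analysis"
begin

text \<open>For \<open>f\<close> of mean zero on \<open>b\<close>-sets and \<open>g\<close> on \<open>a\<close>-sets, the correlation of \<open>g s\<close> and \<open>f t\<close> over
  random disjoint \<open>s\<close>, \<open>t\<close> is at most \<open>a b \<lambda>\<close> times the norms, by induction on \<open>b\<close> simultaneously in all
  links: conditioning on a random vertex \<open>v\<close> of \<open>t\<close>, the centred part of \<open>f\<close> contributes
  \<open>a (b - 1) \<lambda>\<close> in the link of \<open>v\<close>, and the conditional means, a function of \<open>v\<close> with mean zero,
  contribute \<open>a \<lambda>\<close>. Exchanging \<open>a\<close> and \<open>b\<close> reduces the case \<open>b = 1\<close> to \<open>a = b = 1\<close>, which is the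
  spectral hypothesis on the underlying graph of the link. Norms enter in the quadratic form
  \<open>2 |\<langle>f, g\<rangle>| \<le> c (|f|\<^sup>2 + |g|\<^sup>2)\<close>, which adds up over the links without Cauchy--Schwarz.\<close>


section \<open>Quadratic forms on a finite weighted set\<close>

text \<open>Functions are pinned to 0 off \<open>V\<close> so that Tychonoff's theorem applies: the
  term of \<open>v\<close> in the norm confines \<open>f v\<close> to a compact interval, and both
  constraints are closed conditions.\<close>

lemma compact_weighted_sphere:
  fixes m :: "'v \<Rightarrow> real"
  assumes fin: "finite V" and pos: "\<And>v. v \<in> V \<Longrightarrow> 0 < m v"
  shows "compact {f. (\<forall>v. v \<notin> V \<longrightarrow> f v = 0) \<and> (\<Sum>v\<in>V. m v * (f v)\<^sup>2) = 1 \<and> (\<Sum>v\<in>V. m v * f v) = 0}"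
    (is "compact ?K")
proof -
  let ?I = "\<lambda>v. if v \<in> V then {- sqrt (1 / m v)..sqrt (1 / m v)} else {0}"
  let ?N = "\<lambda>f :: 'v \<Rightarrow> real. \<Sum>v\<in>V. m v * (f v)\<^sup>2" and ?M = "\<lambda>f :: 'v \<Rightarrow> real. \<Sum>v\<in>V. m v * f v"
  have "compactin (product_topology (\<lambda>_. euclidean) UNIV) (PiE UNIV ?I)"
    by (subst compactin_PiE) auto
  then have cpt: "compact (PiE UNIV ?I)"
    by (simp add: euclidean_product_topology)
  have coord: "continuous_on UNIV (\<lambda>f :: 'v \<Rightarrow> real. f v)" for v
    by (rule continuous_on_product_coordinates)
  have "closed (?N -` {1})"
    by (rule closed_vimage) (auto intro!: continuous_on_sum continuous_on_mult continuous_on_power continuous_on_const coord)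
  moreover have "closed (?M -` {0})"
    by (rule closed_vimage) (auto intro!: continuous_on_sum continuous_on_mult continuous_on_const coord)
  ultimately have "compact (PiE UNIV ?I \<inter> (?N -` {1} \<inter> ?M -` {0}))"
    using cpt by (intro compact_Int_closed closed_Int)
  moreover have "PiE UNIV ?I \<inter> (?N -` {1} \<inter> ?M -` {0}) = ?K"
  proof -
    have "f v \<in> ?I v" if f: "f \<in> ?K" for f v
    proof (cases "v \<in> V")
      case True
      have "m v * (f v)\<^sup>2 \<le> ?N f"
        using fin True pos by (intro member_le_sum) (auto simp: less_imp_le)
      then have "(f v)\<^sup>2 \<le> 1 / m v"
        using f pos[OF True] by (simp add: field_simps)
      then have "\<bar>f v\<bar> \<le> sqrt (1 / m v)"
        by (metis real_sqrt_abs real_sqrt_le_iff)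
      then show ?thesis using True by (auto simp: abs_le_iff)
    qed (use f in auto)
    then have "?K \<subseteq> PiE UNIV ?I" by (simp only: subset_iff PiE_UNIV_domain Pi_iff) blast
    moreover have "f v = 0" if "f \<in> PiE UNIV ?I" "v \<notin> V" for f v
      using PiE_mem[OF that(1), of v] that(2) by simp
    ultimately show ?thesis by blast
  qed
  ultimately show ?thesis by simp
qed

text \<open>A maximiser of the Rayleigh quotient on the orthogonal complement of the constants is an
  eigenvector: perturbing it in the direction of its own residual cannot increase the quotient.\<close>
lemma quadratic_form_le_if_eigenvalues_le:
  fixes B :: "'v \<Rightarrow> 'v \<Rightarrow> real" and m h :: "'v \<Rightarrow> real"
  assumes fin: "finite V" and pos: "\<And>v. v \<in> V \<Longrightarrow> 0 < m v"
    and sym: "\<And>v x. B v x = B x v"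
    and rows: "\<And>v. v \<in> V \<Longrightarrow> (\<Sum>x\<in>V. B v x) = c * m v"
    and eig: "\<And>mu f. \<lbrakk>\<And>v. v \<in> V \<Longrightarrow> (\<Sum>x\<in>V. B v x * f x) = mu * m v * f v;
        \<exists>v\<in>V. f v \<noteq> 0; (\<Sum>v\<in>V. m v * f v) = 0\<rbrakk> \<Longrightarrow> mu \<le> L"
    and h: "(\<Sum>v\<in>V. m v * h v) = 0"
  shows "(\<Sum>v\<in>V. \<Sum>x\<in>V. B v x * h x * h v) \<le> L * (\<Sum>v\<in>V. m v * (h v)\<^sup>2)"
proof (cases "\<forall>v\<in>V. h v = 0")
  case True
  then show ?thesis by simp
next
  case False
  define q where "q f = (\<Sum>v\<in>V. \<Sum>x\<in>V. B v x * f x * f v)" for f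
  define N where "N f = (\<Sum>v\<in>V. m v * (f v)\<^sup>2)" for f
  define K where "K = {f. (\<forall>v. v \<notin> V \<longrightarrow> f v = 0) \<and> N f = 1 \<and> (\<Sum>v\<in>V. m v * f v) = 0}"
  have Npos: "N f > 0" if "\<exists>v\<in>V. f v \<noteq> 0" for f
  proof -
    from that obtain v where "v \<in> V" "f v \<noteq> 0" by blast
    then show ?thesis unfolding N_def using fin pos
      by (intro sum_pos2[of _ v]) (auto simp: less_imp_le)
  qed
  \<comment> \<open>Reduction to the compact set \<open>K\<close>: \<open>q\<close> and
    \<open>N\<close> are both homogeneous of degree 2 and see only the values on
    \<open>V\<close>.\<close>
  define proj where "proj f v = (if v \<in> V then f v / sqrt (N f) else 0)" for f v
  have proj: "proj f \<in> K" "q f = q (proj f) * N f"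
    if f: "\<exists>v\<in>V. f v \<noteq> 0" "(\<Sum>v\<in>V. m v * f v) = 0" for f
  proof -
    have N: "N f > 0" using Npos f(1) .
    have "N (proj f) = (\<Sum>v\<in>V. m v * (f v)\<^sup>2 / N f)"
      unfolding N_def[of "proj f"] proj_def using N by (intro sum.cong) (auto simp: power_divide)
    also have "\<dots> = 1" using N by (simp add: sum_divide_distrib[symmetric] N_def[symmetric])
    finally have "N (proj f) = 1" .
    moreover have "(\<Sum>v\<in>V. m v * proj f v) = (\<Sum>v\<in>V. m v * f v) / sqrt (N f)"
      unfolding proj_def sum_divide_distrib by (intro sum.cong) auto
    ultimately show "proj f \<in> K" using f(2) by (auto simp: K_def proj_def)
    have "q (proj f) = (\<Sum>v\<in>V. \<Sum>x\<in>V. B v x * f x * f v / N f)"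
      unfolding q_def proj_def using N by (intro sum.cong refl) (simp add: field_simps)
    also have "\<dots> = q f / N f" by (simp add: q_def sum_divide_distrib)
    finally show "q f = q (proj f) * N f" using N by simp
  qed
  have coord: "continuous_on A (\<lambda>f :: 'v \<Rightarrow> real. f v)" for v A
    by (rule continuous_on_subset[OF continuous_on_product_coordinates]) simp
  have "compact K"
    using compact_weighted_sphere[OF fin pos] by (simp add: K_def N_def)
  moreover have "K \<noteq> {}" using proj(1)[of h] False h by auto
  moreover have "continuous_on K q"
    unfolding q_def by (intro continuous_intros coord)
  ultimately obtain p where p: "p \<in> K" and max: "\<And>f. f \<in> K \<Longrightarrow> q f \<le> q p"
    using continuous_attains_sup[of K q] by blast
  define mu where "mu = q p"
  have le: "q f \<le> mu * N f" if f: "(\<Sum>v\<in>V. m v * f v) = 0" for f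
  proof (cases "\<exists>v\<in>V. f v \<noteq> 0")
    case True
    then show ?thesis using proj[OF True f] max[of "proj f"] Npos[OF True]
      by (simp add: mu_def mult_right_mono)
  qed (simp add: q_def N_def)
  have p1: "N p = 1" and p0: "(\<Sum>v\<in>V. m v * p v) = 0" using p by (auto simp: K_def)
  define k where "k v = (\<Sum>x\<in>V. B v x * p x) / m v - mu * p v" for v
  have mk: "m v * k v = (\<Sum>x\<in>V. B v x * p x) - mu * m v * p v" if "v \<in> V" for v
    using pos[OF that] by (simp add: k_def field_simps)
  \<comment> \<open>By symmetry and the row sums, the operator of \<open>B\<close> relative to
    \<open>m\<close> preserves mean zero. So the residual \<open>k\<close> has mean zero and
    \<open>p + e * k\<close> is admissible in \<open>le\<close>.\<close>
  have "(\<Sum>v\<in>V. \<Sum>x\<in>V. B v x * p x) = (\<Sum>x\<in>V. \<Sum>v\<in>V. B x v * p x)"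
    by (subst sum.swap) (simp add: sym)
  also have "\<dots> = (\<Sum>x\<in>V. c * (m x * p x))"
    by (intro sum.cong refl) (simp add: sum_distrib_right[symmetric] rows)
  also have "\<dots> = 0" by (simp add: sum_distrib_left[symmetric] p0)
  finally have Bp: "(\<Sum>v\<in>V. \<Sum>x\<in>V. B v x * p x) = 0" .
  have "(\<Sum>v\<in>V. m v * k v) = (\<Sum>v\<in>V. \<Sum>x\<in>V. B v x * p x) - mu * (\<Sum>v\<in>V. m v * p v)"
    by (simp add: mk sum_subtractf sum_distrib_left mult.assoc)
  then have k0: "(\<Sum>v\<in>V. m v * k v) = 0" by (simp add: Bp p0)
  define i where "i = (\<Sum>v\<in>V. m v * p v * k v)"
  define j where "j = (\<Sum>v\<in>V. \<Sum>x\<in>V. B v x * p x * k v)"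
  have "N k = (\<Sum>v\<in>V. (m v * k v) * k v)" by (simp add: N_def power2_eq_square mult.assoc)
  also have "\<dots> = (\<Sum>v\<in>V. (\<Sum>x\<in>V. B v x * p x) * k v - mu * (m v * p v * k v))"
    by (intro sum.cong refl) (simp only: mk, simp add: algebra_simps)
  also have "\<dots> = j - mu * i"
    by (simp add: sum_subtractf i_def j_def sum_distrib_left sum_distrib_right)
  finally have Nk: "N k = j - mu * i" .
  have jsym: "(\<Sum>v\<in>V. \<Sum>x\<in>V. B v x * k x * p v) = j"
    unfolding j_def by (subst sum.swap) (simp add: sym mult_ac)
  have Nexp: "N (\<lambda>v. p v + e * k v) = 1 + 2 * e * i + e\<^sup>2 * N k" for e
  proof -
    have "N (\<lambda>v. p v + e * k v) = (\<Sum>v\<in>V. m v * (p v)\<^sup>2 + 2 * e * (m v * p v * k v) + e\<^sup>2 * (m v * (k v)\<^sup>2))"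
      unfolding N_def by (intro sum.cong refl) (simp add: power2_eq_square algebra_simps)
    then show ?thesis
      by (simp add: sum.distrib sum_distrib_left[symmetric] i_def p1 N_def[symmetric])
  qed
  have qexp: "q (\<lambda>v. p v + e * k v) = mu + 2 * e * j + e\<^sup>2 * q k" for e
  proof -
    have "q (\<lambda>v. p v + e * k v) = (\<Sum>v\<in>V. \<Sum>x\<in>V. B v x * p x * p v + e * (B v x * p x * k v)
        + e * (B v x * k x * p v) + e\<^sup>2 * (B v x * k x * k v))"
      unfolding q_def by (intro sum.cong refl) (simp add: power2_eq_square algebra_simps)
    also have "\<dots> = q p + e * j + e * j + e\<^sup>2 * q k"
      by (simp add: sum.distrib sum_distrib_left[symmetric] jsym)
         (simp add: q_def j_def)
    finally show ?thesis by (simp add: mu_def)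
  qed
  define D where "D = mu * N k - q k"
  have D0: "D \<ge> 0" using le[OF k0] by (simp add: D_def)
  \<comment> \<open>This is \<open>le\<close> at \<open>p + e * k\<close>: by \<open>Nk\<close> the
    term linear in \<open>e\<close> is \<open>2 * e * N k\<close>, and it has to be dominated by the
    quadratic one for every \<open>e\<close>.\<close>
  have ineq: "2 * e * N k \<le> e\<^sup>2 * D" for e
  proof -
    have "(\<Sum>v\<in>V. m v * (p v + e * k v)) = (\<Sum>v\<in>V. m v * p v) + e * (\<Sum>v\<in>V. m v * k v)"
      by (simp add: sum.distrib sum_distrib_left algebra_simps)
    then have "q (\<lambda>v. p v + e * k v) \<le> mu * N (\<lambda>v. p v + e * k v)"
      by (intro le) (simp add: k0 p0)
    then show ?thesis unfolding Nexp qexp Nk D_def by (simp add: algebra_simps)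
  qed
  have "\<not> N k > 0"
  proof
    assume Nk0: "N k > 0"
    \<comment> \<open>With denominator \<open>D + 1\<close>, which is positive even if
      \<open>D = 0\<close>, one gets \<open>e * D \<le> N k\<close>, against
      \<open>2 * N k \<le> e * D\<close>.\<close>
    define e where "e = N k / (D + 1)"
    have e: "e > 0" using Nk0 D0 by (simp add: e_def)
    have "e * (2 * N k) \<le> e * (e * D)" using ineq[of e] by (simp add: power2_eq_square mult_ac)
    then have "2 * N k \<le> e * D" using e by simp
    also have "\<dots> \<le> e * (D + 1)" using e by simp
    also have "\<dots> = N k" using D0 by (simp add: e_def)
    finally show False using Nk0 by simp
  qed
  then have kz: "k v = 0" if "v \<in> V" for v using Npos[of k] that by blast
  have "mu \<le> L"
  proof (rule eig[of p])
    show "(\<Sum>x\<in>V. B v x * p x) = mu * m v * p v" if "v \<in> V" for v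
      using mk[OF that] kz[OF that] by simp
    show "\<exists>v\<in>V. p v \<noteq> 0"
    proof (rule ccontr)
      assume "\<not> ?thesis"
      then have "N p = 0" by (simp add: N_def)
      with p1 show False by simp
    qed
  qed (rule p0)
  moreover have "N h \<ge> 0" using Npos[of h] False by auto
  ultimately have "mu * N h \<le> L * N h" by (rule mult_right_mono)
  with le[OF h] show ?thesis by (simp add: q_def N_def)
qed

section \<open>Double counting over subsets of fixed size\<close>

definition k_subsets :: "'v set \<Rightarrow> nat \<Rightarrow> 'v set set" where
  "k_subsets S k = {t. t \<subseteq> S \<and> card t = k}"

lemma finite_k_subsets [simp]: "finite S \<Longrightarrow> finite (k_subsets S k)"
  unfolding k_subsets_def by (rule finite_subset[of _ "Pow S"]) auto

lemma card_k_subsets: "finite S \<Longrightarrow> card (k_subsets S k) = card S choose k"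
  unfolding k_subsets_def by (rule n_subsets)

lemma sum_k_subsets_1: "(\<Sum>t\<in>k_subsets S 1. f t) = (\<Sum>v\<in>S. f {v})"
proof -
  have "k_subsets S 1 = (\<lambda>v. {v}) ` S" by (auto simp: k_subsets_def card_1_singleton_iff)
  then show ?thesis by (simp add: sum.reindex)
qed

text \<open>Both sides count sets with one marked element; a set of size \<open>Suc k\<close> can be
  marked in \<open>Suc k\<close> ways.\<close>

lemma sum_k_subsets_insert:
  fixes f :: "'v set \<Rightarrow> real"
  assumes "finite S"
  shows "(\<Sum>v\<in>S. \<Sum>t\<in>k_subsets (S - {v}) k. f (insert v t)) = real (Suc k) * (\<Sum>t\<in>k_subsets S (Suc k). f t)"
proof -
  have "(\<Sum>v\<in>S. \<Sum>t\<in>k_subsets (S - {v}) k. f (insert v t))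
      = (\<Sum>(v, t)\<in>(SIGMA v:S. k_subsets (S - {v}) k). f (insert v t))"
    using assms by (intro sum.Sigma) auto
  also have "\<dots> = (\<Sum>(t, v)\<in>(SIGMA t:k_subsets S (Suc k). t). f t)"
    using assms
    by (intro sum.reindex_bij_witness[of _ "\<lambda>(t, v). (v, t - {v})" "\<lambda>(v, t). (insert v t, v)"])
       (auto simp: k_subsets_def card_insert_if finite_subset insert_absorb dest: finite_subset)
  also have "\<dots> = (\<Sum>t\<in>k_subsets S (Suc k). \<Sum>v\<in>t. f t)"
    using assms by (intro sum.Sigma[symmetric]) (auto simp: k_subsets_def dest: finite_subset)
  also have "\<dots> = (\<Sum>t\<in>k_subsets S (Suc k). real (Suc k) * f t)"
    by (intro sum.cong) (auto simp: k_subsets_def)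
  finally show ?thesis by (simp add: sum_distrib_left)
qed

text \<open>Both sides run over the ordered pairs of disjoint subsets of sizes \<open>a\<close> and
  \<open>b\<close>.\<close>

lemma sum_k_subsets_swap:
  assumes "finite S"
  shows "(\<Sum>t\<in>k_subsets S b. \<Sum>s\<in>k_subsets (S - t) a. h s t) = (\<Sum>s\<in>k_subsets S a. \<Sum>t\<in>k_subsets (S - s) b. h s t)"
proof -
  have "(\<Sum>t\<in>k_subsets S b. \<Sum>s\<in>k_subsets (S - t) a. h s t) = (\<Sum>(t, s)\<in>(SIGMA t:k_subsets S b. k_subsets (S - t) a). h s t)"
    using assms by (intro sum.Sigma) auto
  also have "\<dots> = (\<Sum>(s, t)\<in>(SIGMA s:k_subsets S a. k_subsets (S - s) b). h s t)"
    by (intro sum.reindex_bij_witness[of _ "\<lambda>(s, t). (t, s)" "\<lambda>(t, s). (s, t)"])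
       (auto simp: k_subsets_def)
  also have "\<dots> = (\<Sum>s\<in>k_subsets S a. \<Sum>t\<in>k_subsets (S - s) b. h s t)"
    using assms by (intro sum.Sigma[symmetric]) auto
  finally show ?thesis .
qed

lemma sum_k_subsets_const:
  assumes "finite S" "t \<in> k_subsets S b"
  shows "(\<Sum>s\<in>k_subsets (S - t) a. c) = real ((card S - b) choose a) * c"
proof -
  have "card (S - t) = card S - b"
    using assms by (auto simp: k_subsets_def card_Diff_subset finite_subset)
  then show ?thesis using assms(1) by (simp add: card_k_subsets)
qed

text \<open>Each \<open>s\<close> is met once for every element outside it; this is the exchange of
  summation with singletons on one side.\<close>

lemma sum_k_subsets_remove:
  fixes g :: "'v set \<Rightarrow> real"
  assumes "finite S"
  shows "(\<Sum>v\<in>S. \<Sum>s\<in>k_subsets (S - {v}) a. g s) = real (card S - a) * (\<Sum>s\<in>k_subsets S a. g s)"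
proof -
  have "(\<Sum>v\<in>S. \<Sum>s\<in>k_subsets (S - {v}) a. g s) = (\<Sum>s\<in>k_subsets S a. \<Sum>t\<in>k_subsets (S - s) 1. g s)"
    by (subst sum_k_subsets_swap[OF assms, symmetric]) (simp only: sum_k_subsets_1)
  also have "\<dots> = (\<Sum>s\<in>k_subsets S a. real (card S - a) * g s)"
    by (intro sum.cong refl) (subst sum_k_subsets_const[OF assms], assumption, simp)
  finally show ?thesis by (simp add: sum_distrib_left)
qed

text \<open>Both products count ordered pairs of disjoint subsets of sizes \<open>a\<close> and
  \<open>b\<close> in an \<open>n\<close>-set.\<close>

lemma choose_mult_commute:
  assumes "a + b \<le> n"
  shows "(n choose a) * ((n - a) choose b) = (n choose b) * ((n - b) choose a)"
  using choose_mult[of a "a + b" n] choose_mult[of b "a + b" n] binomial_symmetric[of a "a + b"] assms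
  by simp

section \<open>Unnormalised sums over the links of a weighted complex\<close>

locale weighted =
  fixes F :: "'v set set" and w :: "'v set \<Rightarrow> real" and d :: nat
  assumes complex: "weighted_complex F w d"
begin

lemma finite_F: "finite F" and finite_top: "u \<in> F \<Longrightarrow> finite u"
  and card_top: "u \<in> F \<Longrightarrow> card u = d + 1" and w_nonneg: "u \<in> F \<Longrightarrow> 0 \<le> w u"
  and sum_w: "(\<Sum>u\<in>F. w u) = 1"
  using complex by (auto simp: weighted_complex_def)

text \<open>Unnormalised expectation, over the top faces of the link of \<open>r\<close>, of a function of the
  link face.\<close>
definition lsum :: "'v set \<Rightarrow> ('v set \<Rightarrow> real) \<Rightarrow> real" where
  "lsum r X = (\<Sum>u\<in>{u \<in> F. r \<subseteq> u}. w u * X (u - r))"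

text \<open>This is \<open>meas F w d r\<close> times \<open>(d + 1) choose card r\<close>; without
  the binomial, sums over different links can be added directly.\<close>

definition wt :: "'v set \<Rightarrow> real" where
  "wt r = (\<Sum>u\<in>{u \<in> F. r \<subseteq> u}. w u)"

text \<open>Up to the factor \<open>wt r\<close> and the number of \<open>k\<close>-subsets, an
  expectation over faces of the link. Sizes count vertices, so \<open>k\<close> stands for dimension
  \<open>k - 1\<close>, and \<open>f\<close> receives the link face, without
  \<open>r\<close>.\<close>

definition face_sum :: "'v set \<Rightarrow> nat \<Rightarrow> ('v set \<Rightarrow> real) \<Rightarrow> real" where
  "face_sum r k f = lsum r (\<lambda>S. \<Sum>t\<in>k_subsets S k. f t)"

text \<open>The unnormalised bilinear form of the complement walk in the link of
  \<open>r\<close>.\<close>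

definition pair_sum :: "'v set \<Rightarrow> nat \<Rightarrow> nat \<Rightarrow> ('v set \<Rightarrow> real) \<Rightarrow> ('v set \<Rightarrow> real) \<Rightarrow> real" where
  "pair_sum r a b g f = lsum r (\<lambda>S. \<Sum>t\<in>k_subsets S b. \<Sum>s\<in>k_subsets (S - t) a. g s * f t)"

lemma finite_star [simp]: "finite {u \<in> F. P u}"
  using finite_F by simp

lemma finite_vertices [simp]: "finite (\<Union>F)"
  using finite_F finite_top by blast

lemma card_link: "u \<in> F \<Longrightarrow> r \<subseteq> u \<Longrightarrow> card (u - r) = d + 1 - card r"
  by (simp add: card_Diff_subset card_top finite_subset[OF _ finite_top])

lemma lsum_cong:
  "(\<And>S. finite S \<Longrightarrow> card S = d + 1 - card r \<Longrightarrow> X S = Y S) \<Longrightarrow> lsum r X = lsum r Y"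
  unfolding lsum_def by (intro sum.cong refl) (auto simp: card_link finite_top)

lemma lsum_mult: "lsum r (\<lambda>S. c * X S) = c * lsum r X"
  by (simp add: lsum_def sum_distrib_left mult_ac)

lemma lsum_add: "lsum r (\<lambda>S. X S + Y S) = lsum r X + lsum r Y"
  by (simp add: lsum_def sum.distrib algebra_simps)

lemma lsum_1: "lsum r (\<lambda>S. 1) = wt r"
  by (simp add: lsum_def wt_def)

lemma lsum_eq_0: "wt r = 0 \<Longrightarrow> lsum r X = 0"
  unfolding wt_def lsum_def
  by (subst (asm) sum_nonneg_eq_0_iff) (auto simp: w_nonneg)

lemma wt_nonneg: "0 \<le> wt r"
  unfolding wt_def by (intro sum_nonneg) (auto simp: w_nonneg)

lemma wt_pos_iff: "0 < wt r \<longleftrightarrow> r \<in> faces F w"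
proof -
  have "wt r = 0 \<longleftrightarrow> (\<forall>u\<in>F. r \<subseteq> u \<longrightarrow> w u = 0)"
    unfolding wt_def by (subst sum_nonneg_eq_0_iff) (auto simp: w_nonneg)
  moreover have "r \<in> faces F w \<longleftrightarrow> (\<exists>u\<in>F. w u \<noteq> 0 \<and> r \<subseteq> u)"
    using w_nonneg unfolding faces_def by (auto simp: less_le)
  ultimately show ?thesis using wt_nonneg[of r] by (auto simp: less_le)
qed

text \<open>The link of \<open>v\<close> in the link of \<open>r\<close> is the link of
  \<open>insert v r\<close>, so the vertex may be chosen before the top face or inside it. The
  localisation identities below rest on this.\<close>

lemma lsum_insert:
  "(\<Sum>v\<in>\<Union>F - r. lsum (insert v r) (X v)) = lsum r (\<lambda>S. \<Sum>v\<in>S. X v (S - {v}))"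
proof -
  have "(\<Sum>v\<in>\<Union>F - r. lsum (insert v r) (X v))
      = (\<Sum>v\<in>\<Union>F - r. \<Sum>u\<in>{u \<in> F. insert v r \<subseteq> u}. w u * X v (u - insert v r))"
    by (simp add: lsum_def)
  also have "\<dots> = (\<Sum>u\<in>{u \<in> F. r \<subseteq> u}. \<Sum>v\<in>u - r. w u * X v (u - insert v r))"
    by (subst sum.Sigma, simp, simp, subst sum.Sigma, simp, use finite_top in force)
       (rule sum.reindex_bij_witness[of _ "\<lambda>(u, v). (v, u)" "\<lambda>(v, u). (u, v)"]; auto)
  also have "\<dots> = lsum r (\<lambda>S. \<Sum>v\<in>S. X v (S - {v}))"
    by (simp add: lsum_def sum_distrib_left Diff_insert[of _ _ r])
  finally show ?thesis .
qed

lemma face_sum_eq_sum: "face_sum r k f = (\<Sum>t\<in>k_subsets (\<Union>F - r) k. wt (r \<union> t) * f t)"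
proof -
  have "(\<Sum>t\<in>k_subsets (\<Union>F - r) k. wt (r \<union> t) * f t)
     = (\<Sum>t\<in>k_subsets (\<Union>F - r) k. \<Sum>u\<in>{u \<in> F. r \<union> t \<subseteq> u}. w u * f t)"
    by (simp add: wt_def sum_distrib_right)
  also have "\<dots> = (\<Sum>u\<in>{u \<in> F. r \<subseteq> u}. \<Sum>t\<in>k_subsets (u - r) k. w u * f t)"
    by (subst sum.Sigma, simp, simp, subst sum.Sigma, simp, use finite_top in force)
       (rule sum.reindex_bij_witness[of _ "\<lambda>(u, v). (v, u)" "\<lambda>(v, u). (u, v)"]; auto simp: k_subsets_def)
  finally show ?thesis by (simp add: face_sum_def lsum_def sum_distrib_left)
qed

lemma face_sum_1: "face_sum r 1 f = (\<Sum>v\<in>\<Union>F - r. wt (insert v r) * f {v})"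
  unfolding face_sum_eq_sum sum_k_subsets_1 by simp

lemma face_sum_const: "face_sum r k (\<lambda>_. c) = real ((d + 1 - card r) choose k) * wt r * c"
proof -
  have "face_sum r k (\<lambda>_. c) = lsum r (\<lambda>S. real ((d + 1 - card r) choose k) * c * 1)"
    unfolding face_sum_def by (rule lsum_cong) (simp add: card_k_subsets)
  then show ?thesis by (simp only: lsum_mult lsum_1) simp
qed

lemma face_sum_mult: "face_sum r k (\<lambda>t. c * f t) = c * face_sum r k f"
  by (simp add: face_sum_def sum_distrib_left[symmetric] lsum_mult)

lemma face_sum_add: "face_sum r k (\<lambda>t. f t + g t) = face_sum r k f + face_sum r k g"
  by (simp add: face_sum_def sum.distrib lsum_add)

lemma face_sum_insert: "(\<Sum>v\<in>\<Union>F - r. face_sum (insert v r) k (\<lambda>t. f (insert v t))) = real (Suc k) * face_sum r (Suc k) f"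
  unfolding face_sum_def lsum_insert lsum_mult[symmetric] by (rule lsum_cong) (rule sum_k_subsets_insert)

lemma face_sum_remove: "(\<Sum>v\<in>\<Union>F - r. face_sum (insert v r) a g) = real (d + 1 - card r - a) * face_sum r a g"
  unfolding face_sum_def lsum_insert lsum_mult[symmetric]
  by (rule lsum_cong) (simp only: sum_k_subsets_remove)

lemma pair_sum_swap: "pair_sum r a b g f = pair_sum r b a f g"
  unfolding pair_sum_def by (rule lsum_cong) (subst sum_k_subsets_swap, assumption, simp only: mult.commute)

lemma pair_sum_add: "pair_sum r a b g (\<lambda>t. f t + f' t) = pair_sum r a b g f + pair_sum r a b g f'"
  by (simp add: pair_sum_def distrib_left sum.distrib lsum_add)

text \<open>Within a top face of the link, every \<open>a\<close>-subset is disjoint from the same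
  number of \<open>b\<close>-subsets, so a constant sees only the total of \<open>g\<close>.\<close>

lemma pair_sum_const: "pair_sum r a b g (\<lambda>_. c) = c * real ((d + 1 - card r - a) choose b) * face_sum r a g"
proof -
  have "pair_sum r a b g (\<lambda>_. c) = lsum r (\<lambda>S. \<Sum>s\<in>k_subsets S a. \<Sum>t\<in>k_subsets (S - s) b. g s * c)"
    unfolding pair_sum_def by (rule lsum_cong) (rule sum_k_subsets_swap)
  also have "\<dots> = lsum r (\<lambda>S. c * real ((d + 1 - card r - a) choose b) * (\<Sum>s\<in>k_subsets S a. g s))"
    by (rule lsum_cong) (simp add: sum_k_subsets_const sum_distrib_left sum_distrib_right mult_ac del: sum_constant)
  finally show ?thesis by (simp add: lsum_mult face_sum_def)
qed

lemma pair_sum_1: "pair_sum r a 1 g f = (\<Sum>v\<in>\<Union>F - r. f {v} * face_sum (insert v r) a g)"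
proof -
  have "pair_sum r a 1 g f = lsum r (\<lambda>S. \<Sum>v\<in>S. \<Sum>s\<in>k_subsets (S - {v}) a. g s * f {v})"
    by (simp only: pair_sum_def sum_k_subsets_1)
  also have "\<dots> = (\<Sum>v\<in>\<Union>F - r. lsum (insert v r) (\<lambda>S. \<Sum>s\<in>k_subsets S a. g s * f {v}))"
    by (rule lsum_insert[symmetric])
  also have "\<dots> = (\<Sum>v\<in>\<Union>F - r. f {v} * face_sum (insert v r) a g)"
    unfolding face_sum_def by (subst lsum_mult[symmetric]) (simp only: sum_distrib_left mult.commute)
  finally show ?thesis .
qed

text \<open>Fixing a vertex of the \<open>Suc b\<close>-face moves the rest of the pair into the
  link of that vertex; each pair is met once per vertex of that face.\<close>

lemma pair_sum_insert:
  "(\<Sum>v\<in>\<Union>F - r. pair_sum (insert v r) a b g (\<lambda>t. f (insert v t))) = real (Suc b) * pair_sum r a (Suc b) g f"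
  unfolding pair_sum_def lsum_insert lsum_mult[symmetric]
proof (rule lsum_cong)
  fix S :: "'v set" assume S: "finite S"
  have eq: "S - {v} - t = S - insert v t" for v t by auto
  show "(\<Sum>v\<in>S. \<Sum>t\<in>k_subsets (S - {v}) b. \<Sum>s\<in>k_subsets (S - {v} - t) a. g s * f (insert v t))
      = real (Suc b) * (\<Sum>t\<in>k_subsets S (Suc b). \<Sum>s\<in>k_subsets (S - t) a. g s * f t)"
    unfolding eq by (rule sum_k_subsets_insert[OF S])
qed

text \<open>Summing over top faces last exhibits the form as a matrix with entries
  \<open>wt (r \<union> s \<union> t)\<close>, ready for comparison with the edge weights of the
  walk.\<close>

lemma pair_sum_eq_sum:
  "pair_sum r a b g f = (\<Sum>t\<in>k_subsets (\<Union>F - r) b. \<Sum>s\<in>k_subsets (\<Union>F - r - t) a. wt (r \<union> s \<union> t) * g s * f t)"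
proof -
  let ?T = "SIGMA t:k_subsets (\<Union>F - r) b. k_subsets (\<Union>F - r - t) a"
  have "(\<Sum>t\<in>k_subsets (\<Union>F - r) b. \<Sum>s\<in>k_subsets (\<Union>F - r - t) a. wt (r \<union> s \<union> t) * g s * f t)
      = (\<Sum>t\<in>k_subsets (\<Union>F - r) b. \<Sum>s\<in>k_subsets (\<Union>F - r - t) a.
          \<Sum>u\<in>{u \<in> F. r \<union> s \<union> t \<subseteq> u}. w u * (g s * f t))"
    by (simp add: wt_def sum_distrib_right mult.assoc)
  also have "\<dots> = (\<Sum>(t, s)\<in>?T. \<Sum>u\<in>{u \<in> F. r \<union> s \<union> t \<subseteq> u}. w u * (g s * f t))"
    by (rule sum.Sigma) auto
  also have "\<dots> = (\<Sum>(p, u)\<in>(SIGMA p:?T. {u \<in> F. r \<union> snd p \<union> fst p \<subseteq> u}). w u * (g (snd p) * f (fst p)))"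
    unfolding case_prod_unfold by (subst sum.Sigma) (auto simp: case_prod_unfold intro!: finite_SigmaI)
  also have "\<dots> = (\<Sum>(u, p)\<in>(SIGMA u:{u \<in> F. r \<subseteq> u}. SIGMA t:k_subsets (u - r) b. k_subsets (u - r - t) a).
      w u * (g (snd p) * f (fst p)))"
    by (rule sum.reindex_bij_witness[of _ "\<lambda>(u, v). (v, u)" "\<lambda>(v, u). (u, v)"])
       (auto simp: k_subsets_def)
  also have "\<dots> = (\<Sum>u\<in>{u \<in> F. r \<subseteq> u}. \<Sum>p\<in>(SIGMA t:k_subsets (u - r) b. k_subsets (u - r - t) a).
      w u * (g (snd p) * f (fst p)))"
    by (rule sum.Sigma[symmetric]) (auto intro!: finite_SigmaI simp: finite_top)
  also have "\<dots> = pair_sum r a b g f"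
    unfolding pair_sum_def lsum_def
  proof (intro sum.cong refl)
    fix u assume "u \<in> {u \<in> F. r \<subseteq> u}"
    then have "finite u" by (auto simp: finite_top)
    then show "(\<Sum>p\<in>(SIGMA t:k_subsets (u - r) b. k_subsets (u - r - t) a). w u * (g (snd p) * f (fst p)))
      = w u * (\<Sum>t\<in>k_subsets (u - r) b. \<Sum>s\<in>k_subsets (u - r - t) a. g s * f t)"
      by (subst sum.Sigma) (auto simp: sum_distrib_left case_prod_unfold)
  qed
  finally show ?thesis ..
qed

lemma wt_mono: "r \<subseteq> r' \<Longrightarrow> wt r' \<le> wt r"
  unfolding wt_def by (intro sum_mono2) (auto simp: w_nonneg)

lemma wt_eq_0_mono: "wt r = 0 \<Longrightarrow> r \<subseteq> r' \<Longrightarrow> wt r' = 0"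
  using wt_mono[of r r'] wt_nonneg[of r'] by simp

lemma face_sum_nonneg: "(\<And>t. 0 \<le> f t) \<Longrightarrow> 0 \<le> face_sum r k f"
  unfolding face_sum_eq_sum by (intro sum_nonneg mult_nonneg_nonneg wt_nonneg)

lemma face_sum_eq_0: "face_sum r k (\<lambda>_. 1) = 0 \<Longrightarrow> face_sum r k f = 0"
  unfolding face_sum_eq_sum by (subst (asm) sum_nonneg_eq_0_iff) (auto simp: wt_nonneg)

section \<open>Means and variances over the faces of a link\<close>

definition mean :: "'v set \<Rightarrow> nat \<Rightarrow> ('v set \<Rightarrow> real) \<Rightarrow> real" where
  "mean r k f = face_sum r k f / face_sum r k (\<lambda>_. 1)"

text \<open>If the total weight is 0, then \<open>mean\<close> is 0 by the convention for division,
  and the identity survives because every face sum vanishes too.\<close>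

lemma face_sum_mean: "face_sum r k (\<lambda>_. 1) * mean r k f = face_sum r k f"
  using face_sum_eq_0 by (auto simp: mean_def)

lemma face_sum_const_eq: "face_sum r k (\<lambda>_. c) = c * face_sum r k (\<lambda>_. 1)"
  by (simp add: face_sum_const)

lemma face_sum_centred: "face_sum r k (\<lambda>t. f t - mean r k f) = 0"
  using face_sum_add[of r k f "\<lambda>_. - mean r k f"] face_sum_mean[of r k f]
  by (simp add: face_sum_const_eq[of r k "- mean r k f"] mult.commute)

lemma face_sum_variance:
  "face_sum r k (\<lambda>t. (f t - mean r k f)\<^sup>2) = face_sum r k (\<lambda>t. (f t)\<^sup>2) - face_sum r k (\<lambda>_. 1) * (mean r k f)\<^sup>2"
proof -
  let ?c = "mean r k f"
  have "(\<lambda>t. (f t - ?c)\<^sup>2) = (\<lambda>t. (f t)\<^sup>2 + ((- 2 * ?c) * f t + ?c\<^sup>2))"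
    by (simp add: power2_eq_square algebra_simps)
  then have "face_sum r k (\<lambda>t. (f t - ?c)\<^sup>2) = face_sum r k (\<lambda>t. (f t)\<^sup>2) + ((- 2 * ?c) * face_sum r k f + ?c\<^sup>2 * face_sum r k (\<lambda>_. 1))"
    by (simp only: face_sum_add face_sum_mult face_sum_const_eq[of r k "?c\<^sup>2"])
  then show ?thesis
    unfolding face_sum_mean[of r k f, symmetric] by (simp add: power2_eq_square algebra_simps)
qed

lemma face_sum_centred_le: "face_sum r k (\<lambda>t. (f t - mean r k f)\<^sup>2) \<le> face_sum r k (\<lambda>t. (f t)\<^sup>2)"
  using face_sum_nonneg[of "\<lambda>_. 1" r k] by (simp add: face_sum_variance)

text \<open>Jensen's inequality, read off from the nonnegative variance.\<close>

lemma mean_sq_le: "face_sum r k (\<lambda>_. 1) * (mean r k f)\<^sup>2 \<le> face_sum r k (\<lambda>t. (f t)\<^sup>2)"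
  using face_sum_nonneg[of "\<lambda>t. (f t - mean r k f)\<^sup>2" r k] by (simp add: face_sum_variance)

section \<open>The bound on the pair form and its induction over face sizes\<close>

lemma pair_sum_mult: "pair_sum r a b g (\<lambda>t. c * f t) = c * pair_sum r a b g f"
  by (simp add: pair_sum_def lsum_mult[symmetric] sum_distrib_left mult_ac)

lemma pair_sum_eq_0: "wt r = 0 \<Longrightarrow> pair_sum r a b g f = 0"
  by (simp add: pair_sum_def lsum_eq_0)

text \<open>The weights \<open>(n - b) choose a\<close> and \<open>(n - a) choose b\<close>, where \<open>n\<close> is the size of the top faces of
  the link of \<open>r\<close>, count the complements of a \<open>b\<close>-face and of an \<open>a\<close>-face; they replace the
  normalisation of the measures.\<close>
definition pair_bounded :: "real \<Rightarrow> 'v set \<Rightarrow> nat \<Rightarrow> nat \<Rightarrow> bool" where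
  "pair_bounded L r a b \<longleftrightarrow> (\<forall>f g. face_sum r b f = 0 \<longrightarrow> 2 * \<bar>pair_sum r a b g f\<bar> \<le> real a * real b * L *
     (real ((d + 1 - card r - b) choose a) * face_sum r b (\<lambda>t. (f t)\<^sup>2)
      + real ((d + 1 - card r - a) choose b) * face_sum r a (\<lambda>s. (g s)\<^sup>2)))"

lemma pair_boundedD:
  "pair_bounded L r a b \<Longrightarrow> face_sum r b f = 0 \<Longrightarrow> 2 * \<bar>pair_sum r a b g f\<bar> \<le> real a * real b * L *
     (real ((d + 1 - card r - b) choose a) * face_sum r b (\<lambda>t. (f t)\<^sup>2)
      + real ((d + 1 - card r - a) choose b) * face_sum r a (\<lambda>s. (g s)\<^sup>2))"
  by (simp add: pair_bounded_def)

lemma pair_bounded_degenerate: "wt r = 0 \<Longrightarrow> pair_bounded L r a b"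
  by (simp add: pair_bounded_def pair_sum_eq_0 face_sum_def lsum_eq_0)

text \<open>The definition asks for mean zero on one side only. Against a mean-zero \<open>f\<close>
  the mean of \<open>g\<close> contributes nothing, so \<open>g\<close> may be centred, which does
  not increase its norm, and take the other role.\<close>

lemma pair_bounded_swap:
  assumes "pair_bounded L r a b" and L: "0 \<le> L"
  shows "pair_bounded L r b a"
  unfolding pair_bounded_def
proof (intro allI impI)
  fix f g assume f: "face_sum r a f = 0"
  let ?c = "mean r b g" and ?g = "\<lambda>t. g t - mean r b g"
  have "pair_sum r b a g f = pair_sum r a b f (\<lambda>t. ?g t + ?c)" by (simp add: pair_sum_swap)
  also have "\<dots> = pair_sum r a b f ?g" by (simp only: pair_sum_add pair_sum_const) (simp add: f)
  finally have "2 * \<bar>pair_sum r b a g f\<bar> \<le> real a * real b * L *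
     (real ((d + 1 - card r - b) choose a) * face_sum r b (\<lambda>t. (?g t)\<^sup>2)
      + real ((d + 1 - card r - a) choose b) * face_sum r a (\<lambda>s. (f s)\<^sup>2))"
    using pair_boundedD[OF assms(1), of ?g f] face_sum_centred by simp
  also have "\<dots> \<le> real a * real b * L *
     (real ((d + 1 - card r - b) choose a) * face_sum r b (\<lambda>t. (g t)\<^sup>2)
      + real ((d + 1 - card r - a) choose b) * face_sum r a (\<lambda>s. (f s)\<^sup>2))"
    using L face_sum_centred_le by (intro mult_left_mono add_right_mono) auto
  finally show "2 * \<bar>pair_sum r b a g f\<bar> \<le> real b * real a * L *
     (real ((d + 1 - card r - a) choose b) * face_sum r a (\<lambda>t. (f t)\<^sup>2)
      + real ((d + 1 - card r - b) choose a) * face_sum r b (\<lambda>s. (g s)\<^sup>2))"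
    by (simp only: mult_ac add_ac)
qed

text \<open>Garland's method: a random vertex \<open>v\<close> of the \<open>(b+1)\<close>-face is fixed. In the link of \<open>v\<close> the
  form is bounded on the centred part of \<open>f\<close>; the means over the links form a function on
  vertices, to which the bound for \<open>b = 1\<close> applies.\<close>
lemma pair_bounded_Suc:
  assumes fin: "finite r" and le: "card r + a + Suc b \<le> d + 1" and L: "0 \<le> L"
    and links: "\<And>v. v \<in> \<Union>F - r \<Longrightarrow> pair_bounded L (insert v r) a b"
    and vertex: "pair_bounded L r a 1"
  shows "pair_bounded L r a (Suc b)"
  unfolding pair_bounded_def
proof (intro allI impI)
  fix f g assume f: "face_sum r (Suc b) f = 0"
  define n where "n = d + 1 - card r"
  have n: "a + Suc b \<le> n" using le by (simp add: n_def)
  have card: "d + 1 - card (insert v r) = n - 1" if "v \<in> \<Union>F - r" for v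
    using that fin by (simp add: n_def)
  define fv where "fv v t = f (insert v t)" for v t
  define c where "c v = mean (insert v r) b (fv v)" for v
  \<comment> \<open>The vertex function \<open>c\<close> as a function on singletons, the form to
    which \<open>vertex\<close> applies.\<close>
  define cs where "cs t = c (the_elem t)" for t
  define Nf where "Nf = face_sum r (Suc b) (\<lambda>t. (f t)\<^sup>2)"
  define Ng where "Ng = face_sum r a (\<lambda>s. (g s)\<^sup>2)"
  define \<alpha> where "\<alpha> = real ((n - Suc b) choose a)"
  define \<beta> where "\<beta> = real ((n - a) choose Suc b)"
  define \<gamma> where "\<gamma> = real ((n - 1 - a) choose b)"
  define \<delta> where "\<delta> = real ((n - 1) choose b)"
  define \<epsilon> where "\<epsilon> = real ((n - 1) choose a)"
  have \<delta>: "\<delta> > 0" using n by (simp add: \<delta>_def zero_less_binomial_iff)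
  have nb: "n - 1 - b = n - Suc b" and na: "n - 1 - a = n - a - 1" by auto
  \<comment> \<open>Disjoint pairs of sizes \<open>a\<close> and \<open>b\<close> among
    \<open>n - 1\<close> vertices, counted in two orders; this gives the vertex contribution the
    same weight \<open>\<alpha>\<close> as the centred one.\<close>
  have \<gamma>\<epsilon>: "\<epsilon> * \<gamma> = \<delta> * \<alpha>"
    using choose_mult_commute[of a b "n - 1"] n
    unfolding \<alpha>_def \<gamma>_def \<delta>_def \<epsilon>_def nb of_nat_mult[symmetric] by simp
  have \<gamma>\<beta>: "real (n - a) * \<gamma> = real (Suc b) * \<beta>"
    unfolding \<gamma>_def \<beta>_def na of_nat_mult[symmetric] by (simp only: binomial_absorption)
  have link: "2 * \<bar>pair_sum (insert v r) a b g (fv v) - c v * \<gamma> * face_sum (insert v r) a g\<bar>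
      \<le> real a * real b * L * (\<alpha> * face_sum (insert v r) b (\<lambda>t. (fv v t)\<^sup>2) + \<gamma> * face_sum (insert v r) a (\<lambda>s. (g s)\<^sup>2))"
    if v: "v \<in> \<Union>F - r" for v
  proof -
    have "pair_sum (insert v r) a b g (fv v) = pair_sum (insert v r) a b g (\<lambda>t. (fv v t - c v) + c v)" by simp
    also have "\<dots> = pair_sum (insert v r) a b g (\<lambda>t. fv v t - c v) + c v * \<gamma> * face_sum (insert v r) a g"
      by (simp only: pair_sum_add pair_sum_const card[OF v] \<gamma>_def)
    finally have "2 * \<bar>pair_sum (insert v r) a b g (fv v) - c v * \<gamma> * face_sum (insert v r) a g\<bar>
        \<le> real a * real b * L * (\<alpha> * face_sum (insert v r) b (\<lambda>t. (fv v t - c v)\<^sup>2) + \<gamma> * face_sum (insert v r) a (\<lambda>s. (g s)\<^sup>2))"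
      using pair_boundedD[OF links[OF v], of "\<lambda>t. fv v t - c v" g] face_sum_centred[of "insert v r" b "fv v"]
      unfolding card[OF v] \<alpha>_def \<gamma>_def nb by (simp add: c_def)
    also have "\<dots> \<le> real a * real b * L * (\<alpha> * face_sum (insert v r) b (\<lambda>t. (fv v t)\<^sup>2) + \<gamma> * face_sum (insert v r) a (\<lambda>s. (g s)\<^sup>2))"
      using L face_sum_centred_le[of "insert v r" b "fv v"]
      by (intro mult_left_mono add_right_mono) (auto simp: \<alpha>_def c_def)
    finally show ?thesis .
  qed
  have R: "pair_sum r a 1 g cs = (\<Sum>v\<in>\<Union>F - r. c v * face_sum (insert v r) a g)"
    by (simp only: pair_sum_1 cs_def the_elem_eq)
  \<comment> \<open>Localisation is exact: what the conditional means carry, summed over all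
    \<open>v\<close>, is precisely \<open>\<gamma>\<close> times the form for
    \<open>b = 1\<close>.\<close>
  have "real (Suc b) * pair_sum r a (Suc b) g f - \<gamma> * pair_sum r a 1 g cs
      = (\<Sum>v\<in>\<Union>F - r. pair_sum (insert v r) a b g (fv v) - c v * \<gamma> * face_sum (insert v r) a g)"
    unfolding R fv_def pair_sum_insert[symmetric] sum_distrib_left sum_subtractf[symmetric]
    by (simp add: mult_ac)
  then have "2 * \<bar>real (Suc b) * pair_sum r a (Suc b) g f - \<gamma> * pair_sum r a 1 g cs\<bar>
      \<le> (\<Sum>v\<in>\<Union>F - r. 2 * \<bar>pair_sum (insert v r) a b g (fv v) - c v * \<gamma> * face_sum (insert v r) a g\<bar>)"
    using sum_abs by (simp add: sum_distrib_left[symmetric])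
  also have "\<dots> \<le> (\<Sum>v\<in>\<Union>F - r. real a * real b * L *
      (\<alpha> * face_sum (insert v r) b (\<lambda>t. (fv v t)\<^sup>2) + \<gamma> * face_sum (insert v r) a (\<lambda>s. (g s)\<^sup>2)))"
    by (intro sum_mono link)
  also have "\<dots> = real a * real b * L * (\<alpha> * (real (Suc b) * Nf) + \<gamma> * (real (n - a) * Ng))"
    unfolding Nf_def Ng_def n_def face_sum_insert[symmetric] face_sum_remove[symmetric] fv_def
    by (simp only: sum_distrib_left[symmetric] sum.distrib)
  also have "\<dots> = real (Suc b) * (real a * real b * L * (\<alpha> * Nf + \<beta> * Ng))"
    using \<gamma>\<beta> by (simp add: algebra_simps)
  finally have main: "2 * \<bar>real (Suc b) * pair_sum r a (Suc b) g f - \<gamma> * pair_sum r a 1 g cs\<bar>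
      \<le> real (Suc b) * (real a * real b * L * (\<alpha> * Nf + \<beta> * Ng))" .
  have A1: "face_sum (insert v r) b (\<lambda>_. 1) = \<delta> * wt (insert v r)" if "v \<in> \<Union>F - r" for v
    by (simp only: face_sum_const card[OF that] \<delta>_def mult_1_right)
  \<comment> \<open>Averaging the conditional means recovers the mean of \<open>f\<close>, which is
    0; \<open>\<delta>\<close> is the number of \<open>b\<close>-subsets of a top face in the link
    of \<open>v\<close>.\<close>
  have "\<delta> * face_sum r 1 cs = (\<Sum>v\<in>\<Union>F - r. face_sum (insert v r) b (\<lambda>_. 1) * c v)"
    by (simp only: face_sum_1 cs_def the_elem_eq) (simp add: sum_distrib_left A1 mult.assoc)
  also have "\<dots> = real (Suc b) * face_sum r (Suc b) f"
    by (simp only: c_def face_sum_mean face_sum_insert[symmetric]) (simp add: fv_def[abs_def])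
  finally have cs0: "face_sum r 1 cs = 0" using f \<delta> by simp
  have "\<delta> * face_sum r 1 (\<lambda>t. (cs t)\<^sup>2) = (\<Sum>v\<in>\<Union>F - r. face_sum (insert v r) b (\<lambda>_. 1) * (c v)\<^sup>2)"
    by (simp only: face_sum_1 cs_def the_elem_eq) (simp add: sum_distrib_left A1 mult.assoc)
  also have "\<dots> \<le> (\<Sum>v\<in>\<Union>F - r. face_sum (insert v r) b (\<lambda>t. (fv v t)\<^sup>2))"
    unfolding c_def by (intro sum_mono mean_sq_le)
  also have "\<dots> = real (Suc b) * Nf"
    unfolding Nf_def face_sum_insert[symmetric] fv_def ..
  finally have csq: "\<delta> * face_sum r 1 (\<lambda>t. (cs t)\<^sup>2) \<le> real (Suc b) * Nf" .
  have "2 * \<bar>pair_sum r a 1 g cs\<bar> \<le> real a * L * (\<epsilon> * face_sum r 1 (\<lambda>t. (cs t)\<^sup>2) + real (n - a) * Ng)"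
    using pair_boundedD[OF vertex cs0, of g] by (simp add: \<epsilon>_def n_def Ng_def)
  then have "\<gamma> * (2 * \<bar>pair_sum r a 1 g cs\<bar>) \<le> \<gamma> * (real a * L * (\<epsilon> * face_sum r 1 (\<lambda>t. (cs t)\<^sup>2) + real (n - a) * Ng))"
    by (rule mult_left_mono) (simp add: \<gamma>_def)
  also have "\<dots> = real a * L * ((\<epsilon> * \<gamma>) * face_sum r 1 (\<lambda>t. (cs t)\<^sup>2) + (real (n - a) * \<gamma>) * Ng)"
    by (simp add: algebra_simps)
  also have "\<dots> = real a * L * (\<alpha> * (\<delta> * face_sum r 1 (\<lambda>t. (cs t)\<^sup>2)) + real (Suc b) * \<beta> * Ng)"
    unfolding \<gamma>\<epsilon> \<gamma>\<beta> by (simp add: algebra_simps)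
  also have "\<dots> \<le> real a * L * (\<alpha> * (real (Suc b) * Nf) + real (Suc b) * \<beta> * Ng)"
    using L csq by (intro mult_left_mono add_right_mono) (auto simp: \<alpha>_def)
  finally have rest: "2 * \<bar>\<gamma> * pair_sum r a 1 g cs\<bar> \<le> real (Suc b) * (real a * L * (\<alpha> * Nf + \<beta> * Ng))"
    by (simp add: abs_mult \<gamma>_def algebra_simps)
  have triangle: "2 * \<bar>x\<bar> \<le> 2 * \<bar>x - y\<bar> + 2 * \<bar>y\<bar>" for x y :: real
    using abs_triangle_ineq[of "x - y" y] by simp
  have "real (Suc b) * (2 * \<bar>pair_sum r a (Suc b) g f\<bar>) = 2 * \<bar>real (Suc b) * pair_sum r a (Suc b) g f\<bar>"
    by (simp add: abs_mult)
  also have "\<dots> \<le> 2 * \<bar>real (Suc b) * pair_sum r a (Suc b) g f - \<gamma> * pair_sum r a 1 g cs\<bar> + 2 * \<bar>\<gamma> * pair_sum r a 1 g cs\<bar>"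
    by (rule triangle)
  also have "\<dots> \<le> real (Suc b) * (real a * real b * L * (\<alpha> * Nf + \<beta> * Ng))
      + real (Suc b) * (real a * L * (\<alpha> * Nf + \<beta> * Ng))"
    using main rest by (rule add_mono)
  \<comment> \<open>The two contributions now bound by the same norms, with coefficients
    \<open>a * b\<close> and \<open>a\<close>, which add up to \<open>a * Suc b\<close>.\<close>
  also have "\<dots> = real (Suc b) * (real a * real (Suc b) * L * (\<alpha> * Nf + \<beta> * Ng))"
    by (simp add: algebra_simps)
  finally have "2 * \<bar>pair_sum r a (Suc b) g f\<bar> \<le> real a * real (Suc b) * L * (\<alpha> * Nf + \<beta> * Ng)"
    by (rule mult_left_le_imp_le) simp
  then show "2 * \<bar>pair_sum r a (Suc b) g f\<bar> \<le> real a * real (Suc b) * L *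
     (real ((d + 1 - card r - Suc b) choose a) * face_sum r (Suc b) (\<lambda>t. (f t)\<^sup>2)
      + real ((d + 1 - card r - a) choose Suc b) * face_sum r a (\<lambda>s. (g s)\<^sup>2))"
    by (simp only: \<alpha>_def \<beta>_def Nf_def Ng_def n_def)
qed

lemma pair_bounded_if_bounded_1:
  assumes "finite r" "card r + a + b \<le> d + 1" "1 \<le> b" "0 \<le> L"
    and "\<And>r. \<lbrakk>finite r; card r + a + 1 \<le> d + 1\<rbrakk> \<Longrightarrow> pair_bounded L r a 1"
  shows "pair_bounded L r a b"
  using assms(3,1,2)
proof (induction b arbitrary: r rule: dec_induct)
  case base
  then show ?case using assms(5) by simp
next
  case (step b)
  show ?case
  proof (rule pair_bounded_Suc)
    show "pair_bounded L (insert v r) a b" if "v \<in> \<Union>F - r" for v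
      using that step.prems by (intro step.IH) auto
  qed (use step assms(4,5) in auto)
qed

text \<open>Two inductions joined by an exchange of roles: \<open>(1, 1)\<close> gives
  \<open>(1, a)\<close>, hence \<open>(a, 1)\<close>, hence \<open>(a, b)\<close>. All
  \<open>r\<close> of admissible size are treated at once because each step passes to links of
  larger sets.\<close>

lemma pair_bounded_if_edges_bounded:
  assumes "finite r" "card r + a + b \<le> d + 1" "1 \<le> a" "1 \<le> b" and L: "0 \<le> L"
    and edges: "\<And>r. \<lbrakk>finite r; card r + 2 \<le> d + 1\<rbrakk> \<Longrightarrow> pair_bounded L r 1 1"
  shows "pair_bounded L r a b"
proof (rule pair_bounded_if_bounded_1[OF assms(1,2,4) L])
  fix r :: "'v set" assume r: "finite r" "card r + a + 1 \<le> d + 1"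
  have "pair_bounded L r 1 a"
  proof (rule pair_bounded_if_bounded_1)
    show "pair_bounded L r 1 1" if "finite r" "card r + 1 + 1 \<le> d + 1" for r
      using edges that by simp
  qed (use r assms in auto)
  then show "pair_bounded L r a 1" using L by (rule pair_bounded_swap)
qed

section \<open>The base case: the graph underlying a link\<close>

lemma link_w_eq:
  assumes "u \<in> F" "r \<subseteq> u"
  shows "link_w F w r (u - r) = w u / wt r"
proof -
  have "{u' \<in> F. r \<subseteq> u' \<and> u' - r = u - r} = {u}" using assms by auto
  then show ?thesis by (simp add: link_w_def wt_def)
qed

text \<open>Removing \<open>r\<close> is injective on the top faces that contain it, so link
  measures are values of \<open>wt\<close> up to normalisation.\<close>

lemma meas_link:
  assumes "t \<inter> r = {}"
  shows "meas (link_F F r) (link_w F w r) k t = wt (r \<union> t) / (wt r * real ((k + 1) choose card t))"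
proof -
  have "{u \<in> link_F F r. t \<subseteq> u} = (\<lambda>u. u - r) ` {u \<in> F. r \<union> t \<subseteq> u}"
    using assms by (auto simp: link_F_def)
  moreover have "inj_on (\<lambda>u. u - r) {u \<in> F. r \<union> t \<subseteq> u}"
    by (auto simp: inj_on_def)
  ultimately have "(\<Sum>u\<in>{u \<in> link_F F r. t \<subseteq> u}. link_w F w r u)
      = (\<Sum>u\<in>{u \<in> F. r \<union> t \<subseteq> u}. link_w F w r (u - r))"
    by (simp add: sum.reindex)
  also have "\<dots> = wt (r \<union> t) / wt r"
    by (simp add: link_w_eq wt_def[of "r \<union> t"] sum_divide_distrib)
  finally show ?thesis by (simp add: meas_def)
qed

lemma link_vertices_eq:
  assumes "wt r > 0"
  shows "link_vertices F w r = {v \<in> \<Union>F - r. wt (insert v r) > 0}"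
proof -
  have "0 < link_w F w r (u - r) \<longleftrightarrow> 0 < w u" if "u \<in> F" "r \<subseteq> u" for u
    using assms that by (simp add: link_w_eq zero_less_divide_iff)
  then have "v \<in> link_vertices F w r \<longleftrightarrow> (\<exists>u\<in>F. 0 < w u \<and> insert v r \<subseteq> u) \<and> v \<notin> r" for v
    unfolding link_vertices_def faces_def link_F_def by auto
  then show ?thesis by (auto simp: wt_pos_iff faces_def)
qed

text \<open>Weighted adjacency matrix of the graph of the link, symmetric because it is not yet
  divided by degrees.\<close>

definition link_form :: "'v set \<Rightarrow> 'v \<Rightarrow> 'v \<Rightarrow> real" where
  "link_form r v x = (if v = x then 0 else wt (insert v (insert x r)))"

lemma link_form_sym: "link_form r v x = link_form r x v"
  by (simp add: link_form_def insert_commute)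

lemma face_sum_1_vertices:
  assumes "wt r > 0"
  shows "face_sum r 1 f = (\<Sum>v\<in>link_vertices F w r. wt (insert v r) * f {v})"
  unfolding face_sum_1 link_vertices_eq[OF assms]
  by (rule sum.mono_neutral_right) (use wt_nonneg in \<open>auto simp: less_le\<close>)

lemma face_sum_insert_1_vertices:
  assumes r: "wt r > 0" and v: "v \<in> link_vertices F w r"
  shows "face_sum (insert v r) 1 g = (\<Sum>x\<in>link_vertices F w r. link_form r v x * g {x})"
proof -
  have "face_sum (insert v r) 1 g = (\<Sum>x\<in>\<Union>F - insert v r. link_form r v x * g {x})"
    unfolding face_sum_1 by (intro sum.cong) (auto simp: link_form_def insert_commute)
  also have "\<dots> = (\<Sum>x\<in>\<Union>F - r. link_form r v x * g {x})"
    by (rule sum.mono_neutral_left) (auto simp: link_form_def)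
  also have "\<dots> = (\<Sum>x\<in>link_vertices F w r. link_form r v x * g {x})"
    unfolding link_vertices_eq[OF r]
  proof (rule sum.mono_neutral_right)
    show "\<forall>x\<in>\<Union>F - r - {v \<in> \<Union>F - r. 0 < wt (insert v r)}. link_form r v x * g {x} = 0"
    proof
      fix x assume "x \<in> \<Union>F - r - {v \<in> \<Union>F - r. 0 < wt (insert v r)}"
      then have "wt (insert x r) = 0" using wt_nonneg[of "insert x r"] by (auto simp: less_le)
      then have "wt (insert v (insert x r)) = 0" by (rule wt_eq_0_mono) auto
      then show "link_form r v x * g {x} = 0" by (simp add: link_form_def)
    qed
  qed auto
  finally show ?thesis .
qed

lemma pair_sum_1_1_vertices:
  assumes r: "wt r > 0"
  shows "pair_sum r 1 1 g f = (\<Sum>v\<in>link_vertices F w r. \<Sum>x\<in>link_vertices F w r. link_form r v x * g {x} * f {v})"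
proof -
  have "pair_sum r 1 1 g f = (\<Sum>v\<in>link_vertices F w r. f {v} * face_sum (insert v r) 1 g)"
    unfolding pair_sum_1 link_vertices_eq[OF r]
  proof (rule sum.mono_neutral_right)
    show "\<forall>x\<in>\<Union>F - r - {v \<in> \<Union>F - r. 0 < wt (insert v r)}. f {x} * face_sum (insert x r) 1 g = 0"
    proof
      fix x assume "x \<in> \<Union>F - r - {v \<in> \<Union>F - r. 0 < wt (insert v r)}"
      then have "wt (insert x r) = 0" using wt_nonneg[of "insert x r"] by (auto simp: less_le)
      then show "f {x} * face_sum (insert x r) 1 g = 0" unfolding face_sum_def by (simp only: lsum_eq_0)
    qed
  qed auto
  then show ?thesis
    by (simp only: face_sum_insert_1_vertices[OF r] cong: sum.cong) (simp add: sum_distrib_left mult_ac)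
qed

lemma link_form_row:
  assumes r: "wt r > 0" and fin: "finite r" and v: "v \<in> link_vertices F w r"
  shows "(\<Sum>x\<in>link_vertices F w r. link_form r v x) = real (d - card r) * wt (insert v r)"
proof -
  have "v \<notin> r" using v by (simp add: link_vertices_eq[OF r])
  then show ?thesis
    using face_sum_insert_1_vertices[OF r v, of "\<lambda>_. 1"] fin by (simp add: face_sum_const)
qed

lemma link_walk_eq:
  assumes r: "wt r > 0" and fin: "finite r" and v: "v \<in> link_vertices F w r"
    and card: "card r + 2 \<le> d + 1"
  shows "link_walk F w d r f v
    = (\<Sum>x\<in>link_vertices F w r. link_form r v x * f x) / (real (d - card r) * wt (insert v r))"
proof -
  \<comment> \<open>Common normalisation of the edge measures, which cancels in the walk; it is
    nonzero because top faces of the link have at least two vertices.\<close>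
  define k where "k = wt r * real ((d - card r + 1) choose 2)"
  have k: "k > 0" using r card by (simp add: k_def zero_less_binomial_iff)
  have e: "link_emeas F w d r v x = link_form r v x / k" if "x \<in> link_vertices F w r" for x
  proof (cases "v = x")
    case False
    have "v \<notin> r" "x \<notin> r" using v that by (auto simp: link_vertices_eq[OF r])
    then show ?thesis using False
      by (simp add: link_emeas_def link_form_def meas_link k_def) (simp add: insert_commute numeral_2_eq_2)
  qed (simp add: link_emeas_def link_form_def)
  have "(\<Sum>x\<in>link_vertices F w r. link_emeas F w d r v x * f x)
      = (\<Sum>x\<in>link_vertices F w r. link_form r v x * f x) / k"
    by (simp add: e sum_divide_distrib)
  moreover have "(\<Sum>x\<in>link_vertices F w r. link_emeas F w d r v x) = real (d - card r) * wt (insert v r) / k"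
    by (simp add: e sum_divide_distrib[symmetric] link_form_row[OF r fin v])
  ultimately show ?thesis using k by (simp add: link_walk_def)
qed

text \<open>The walk divides \<open>link_form\<close> by its row sums, which are
  \<open>d - card r\<close> times the vertex weights. This is the factor between its eigenvalues and
  those of \<open>link_form\<close> relative to the weights.\<close>

lemma eigenvalue_bound:
  assumes spec: "link_spectral_ok F w d r lam" and r: "wt r > 0" and fin: "finite r"
    and card: "card r + 2 \<le> d + 1"
    and eig: "\<And>v. v \<in> link_vertices F w r \<Longrightarrow>
        (\<Sum>x\<in>link_vertices F w r. link_form r v x * f x) = mu * wt (insert v r) * f v"
    and nz: "\<exists>v\<in>link_vertices F w r. f v \<noteq> 0"
    and orth: "(\<Sum>v\<in>link_vertices F w r. wt (insert v r) * f v) = 0"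
  shows "\<bar>mu\<bar> \<le> real (d - card r) * lam"
proof -
  let ?k = "real (d - card r)"
  have k: "?k > 0" using card by simp
  have vm: "link_vmeas F w d r v = wt (insert v r) / (wt r * real (d - card r + 1))"
    if "v \<in> link_vertices F w r" for v
    using that by (simp add: link_vmeas_def meas_link link_vertices_eq[OF r])
  have "(\<Sum>v\<in>link_vertices F w r. link_vmeas F w d r v * f v) = 0"
    using orth by (simp add: vm sum_divide_distrib[symmetric])
  moreover have "link_walk F w d r f v = mu / ?k * f v" if v: "v \<in> link_vertices F w r" for v
  proof -
    have "wt (insert v r) > 0" using v by (simp add: link_vertices_eq[OF r])
    then show ?thesis using k by (simp add: link_walk_eq[OF r fin v card] eig[OF v])
  qed
  ultimately have "- lam \<le> mu / ?k \<and> mu / ?k \<le> lam"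
    using spec nz unfolding link_spectral_ok_def by blast
  then show ?thesis using k by (auto simp: abs_le_iff field_simps)
qed

text \<open>The two sides of the spectral hypothesis come in by applying the eigenvalue criterion to
  the form and to its negative.\<close>

lemma link_quadratic_form_bound:
  assumes spec: "link_spectral_ok F w d r lam" and r: "wt r > 0" and fin: "finite r"
    and card: "card r + 2 \<le> d + 1" and h: "face_sum r 1 h = 0"
  shows "\<bar>pair_sum r 1 1 h h\<bar> \<le> real (d - card r) * lam * face_sum r 1 (\<lambda>t. (h t)\<^sup>2)"
proof -
  let ?V = "link_vertices F w r" and ?m = "\<lambda>v. wt (insert v r)" and ?L = "real (d - card r) * lam"
  have finV: "finite ?V"
    unfolding link_vertices_eq[OF r] by (rule finite_subset[OF _ finite_vertices]) auto
  have m: "?m v > 0" if "v \<in> ?V" for v using that by (simp add: link_vertices_eq[OF r])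
  have h': "(\<Sum>v\<in>?V. ?m v * h {v}) = 0" using h by (simp only: face_sum_1_vertices[OF r])
  have "(\<Sum>v\<in>?V. \<Sum>x\<in>?V. link_form r v x * h {x} * h {v}) \<le> ?L * (\<Sum>v\<in>?V. ?m v * (h {v})\<^sup>2)"
  proof (rule quadratic_form_le_if_eigenvalues_le[OF finV m link_form_sym link_form_row[OF r fin] _ h'])
    fix mu f
    assume "\<And>v. v \<in> ?V \<Longrightarrow> (\<Sum>x\<in>?V. link_form r v x * f x) = mu * ?m v * f v"
      "\<exists>v\<in>?V. f v \<noteq> 0" "(\<Sum>v\<in>?V. ?m v * f v) = 0"
    from eigenvalue_bound[OF spec r fin card this] show "mu \<le> ?L" by simp
  qed
  moreover have "(\<Sum>v\<in>?V. \<Sum>x\<in>?V. - link_form r v x * h {x} * h {v}) \<le> ?L * (\<Sum>v\<in>?V. ?m v * (h {v})\<^sup>2)"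
  proof (rule quadratic_form_le_if_eigenvalues_le[OF finV m _ _ _ h'])
    show "(\<Sum>x\<in>?V. - link_form r v x) = - real (d - card r) * ?m v" if "v \<in> ?V" for v
      by (simp add: sum_negf link_form_row[OF r fin that])
    fix mu f
    assume *: "\<And>v. v \<in> ?V \<Longrightarrow> (\<Sum>x\<in>?V. - link_form r v x * f x) = mu * ?m v * f v"
      "\<exists>v\<in>?V. f v \<noteq> 0" "(\<Sum>v\<in>?V. ?m v * f v) = 0"
    have "(\<Sum>x\<in>?V. link_form r v x * f x) = - mu * ?m v * f v" if "v \<in> ?V" for v
      using *(1)[OF that] by (simp add: sum_negf)
    from eigenvalue_bound[OF spec r fin card this *(2,3)] show "mu \<le> ?L" by simp
  qed (simp_all add: link_form_sym)
  ultimately show ?thesis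
    unfolding pair_sum_1_1_vertices[OF r] face_sum_1_vertices[OF r] by (simp add: sum_negf abs_le_iff)
qed

text \<open>Polarisation: the quadratic bound, applied to \<open>f + h\<close> and
  \<open>f - h\<close> with \<open>h\<close> the centred part of \<open>g\<close>, controls the
  bilinear form.\<close>

lemma edges_bounded:
  assumes spec: "link_spectral_ok F w d r lam" and r: "wt r > 0" and fin: "finite r"
    and card: "card r + 2 \<le> d + 1" and lam: "0 \<le> lam"
  shows "pair_bounded lam r 1 1"
  unfolding pair_bounded_def
proof (intro allI impI)
  fix f g assume f: "face_sum r 1 f = 0"
  let ?L = "real (d - card r) * lam" and ?N = "\<lambda>f. face_sum r 1 (\<lambda>t. (f t)\<^sup>2)"
  define c where "c = mean r 1 g"
  define h where "h t = g t - c" for t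
  have h: "face_sum r 1 h = 0" using face_sum_centred[of r 1 g] by (simp add: h_def[abs_def] c_def)
  have "pair_sum r 1 1 g f = pair_sum r 1 1 f (\<lambda>t. h t + c)" by (subst pair_sum_swap) (simp only: h_def diff_add_cancel)
  also have "\<dots> = pair_sum r 1 1 f h" by (simp only: pair_sum_add pair_sum_const f mult_zero_right add_0_right)
  finally have Qh: "pair_sum r 1 1 g f = pair_sum r 1 1 f h" .
  have exp: "pair_sum r 1 1 (\<lambda>t. f t + s * h t) (\<lambda>t. f t + s * h t)
      = pair_sum r 1 1 f f + 2 * s * pair_sum r 1 1 f h + s\<^sup>2 * pair_sum r 1 1 h h" for s
  proof -
    have l: "pair_sum r 1 1 (\<lambda>t. f t + s * h t) k = pair_sum r 1 1 f k + s * pair_sum r 1 1 h k" for k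
      by (subst (1 2 3) pair_sum_swap) (simp only: pair_sum_add pair_sum_mult)
    have "pair_sum r 1 1 h f = pair_sum r 1 1 f h" by (rule pair_sum_swap)
    then show ?thesis
      by (simp only: l pair_sum_add pair_sum_mult) (simp add: power2_eq_square algebra_simps)
  qed
  have Nexp: "?N (\<lambda>t. f t + s * h t) = ?N f + (2 * s) * face_sum r 1 (\<lambda>t. f t * h t) + s\<^sup>2 * ?N h" for s
  proof -
    have "(\<lambda>t. (f t + s * h t)\<^sup>2) = (\<lambda>t. (f t)\<^sup>2 + ((2 * s) * (f t * h t) + s\<^sup>2 * (h t)\<^sup>2))"
      by (simp add: power2_eq_square algebra_simps)
    then show ?thesis by (simp only: face_sum_add face_sum_mult add.assoc)
  qed
  have le: "\<bar>pair_sum r 1 1 f f + 2 * s * pair_sum r 1 1 f h + s\<^sup>2 * pair_sum r 1 1 h h\<bar>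
     \<le> ?L * (?N f + (2 * s) * face_sum r 1 (\<lambda>t. f t * h t) + s\<^sup>2 * ?N h)" for s
    unfolding exp[symmetric] Nexp[symmetric]
    by (rule link_quadratic_form_bound[OF spec r fin card]) (simp add: face_sum_add face_sum_mult f h del: One_nat_def)
  have polar: "2 * \<bar>pair_sum r 1 1 f h\<bar> \<le> ?L * (?N f + ?N h)"
  proof -
    let ?q = "\<lambda>s. pair_sum r 1 1 f f + 2 * s * pair_sum r 1 1 f h + s\<^sup>2 * pair_sum r 1 1 h h"
    \<comment> \<open>The diagonal terms cancel in the difference of the forms, and the cross terms
      cancel when the two norms are added.\<close>
    have "4 * \<bar>pair_sum r 1 1 f h\<bar> = \<bar>?q 1 - ?q (- 1)\<bar>" by (simp add: abs_mult)
    also have "\<dots> \<le> \<bar>?q 1\<bar> + \<bar>?q (- 1)\<bar>" by (rule abs_triangle_ineq4)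
    also have "\<dots> \<le> 2 * (?L * (?N f + ?N h))"
      using add_mono[OF le[of 1] le[of "- 1"]] by (simp add: algebra_simps)
    finally show ?thesis by (simp add: mult_ac)
  qed
  have "?N h \<le> ?N g" using face_sum_centred_le[of r 1 g] by (simp add: h_def c_def)
  then have "?L * ?N h \<le> ?L * ?N g" using lam by (intro mult_left_mono) auto
  then have "2 * \<bar>pair_sum r 1 1 g f\<bar> \<le> ?L * (?N f + ?N g)"
    using polar unfolding Qh by (simp add: distrib_left)
  then show "2 * \<bar>pair_sum r 1 1 g f\<bar> \<le> real 1 * real 1 * lam *
     (real ((d + 1 - card r - 1) choose 1) * face_sum r 1 (\<lambda>t. (f t)\<^sup>2)
      + real ((d + 1 - card r - 1) choose 1) * face_sum r 1 (\<lambda>s. (g s)\<^sup>2))"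
    by (simp add: algebra_simps)
qed

section \<open>Mean-zero functions and the sign of \<open>lam\<close>\<close>

text \<open>Since \<open>b \<le> d\<close>, a top face of positive weight has two distinct
  \<open>b\<close>-subsets, on which a function can be balanced. This serves the sign of
  \<open>lam\<close> and the nonemptiness of the set defining the supremum.\<close>

lemma exists_centred:
  assumes "1 \<le> b" "b \<le> d"
  obtains f where "face_sum {} b f = 0" "face_sum {} b (\<lambda>t. (f t)\<^sup>2) > 0"
proof -
  obtain u where u: "u \<in> F" "w u > 0"
  proof -
    have "\<not> (\<forall>u\<in>F. w u = 0)" using sum_w by (metis sum.neutral zero_neq_one)
    then show ?thesis using that w_nonneg by (force simp: less_le)
  qed
  have pos: "wt t > 0" if "t \<subseteq> u" for t
    using u that unfolding wt_pos_iff faces_def by auto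
  have finu: "finite u" and cu: "card u = d + 1" using u finite_top card_top by auto
  obtain s where s: "s \<subseteq> u" "card s = b"
    using obtain_subset_with_card_n[of b u] cu assms by auto
  obtain x where x: "x \<in> s" using s assms by fastforce
  obtain y where y: "y \<in> u" "y \<notin> s"
  proof -
    have "s \<noteq> u" using s cu assms by auto
    then show ?thesis using that s by blast
  qed
  define t where "t = insert y (s - {x})"
  have fs: "finite s" using s finu finite_subset by blast
  have t: "t \<subseteq> u" "card t = b" "s \<noteq> t"
    using s x y fs assms by (auto simp: t_def card_insert_if)
  \<comment> \<open>Each of the two faces gets the weight of the other, with opposite signs, so the
    weighted values cancel.\<close>
  define f where "f z = (if z = s then wt t else if z = t then - wt s else 0)" for z
  have sub: "{s, t} \<subseteq> k_subsets (\<Union>F - {}) b" using s t u by (auto simp: k_subsets_def)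
  have restrict: "(\<Sum>z\<in>k_subsets (\<Union>F - {}) b. wt ({} \<union> z) * k z) = wt s * k s + wt t * k t"
    if "\<And>z. z \<noteq> s \<Longrightarrow> z \<noteq> t \<Longrightarrow> k z = 0" for k
  proof -
    have "(\<Sum>z\<in>k_subsets (\<Union>F - {}) b. wt ({} \<union> z) * k z) = (\<Sum>z\<in>{s, t}. wt z * k z)"
      by (rule sum.mono_neutral_cong_right) (use sub that in auto)
    then show ?thesis using t(3) by simp
  qed
  show ?thesis
  proof (rule that)
    show "face_sum {} b f = 0" unfolding face_sum_eq_sum using t(3) by (subst restrict) (auto simp: f_def)
    have "face_sum {} b (\<lambda>z. (f z)\<^sup>2) = wt s * (wt t)\<^sup>2 + wt t * (wt s)\<^sup>2"
      unfolding face_sum_eq_sum using t(3) by (subst restrict) (auto simp: f_def)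
    then show "face_sum {} b (\<lambda>t. (f t)\<^sup>2) > 0" using pos[OF s(1)] pos[OF t(1)]
      by (simp add: add_pos_pos)
  qed
qed

lemma wt_empty: "wt {} = 1"
  by (simp add: wt_def sum_w)

text \<open>\<open>d * lam\<close> times the positive norm of a mean-zero function bounds an
  absolute value.\<close>

lemma expander_nonneg:
  assumes "link_spectral_ok F w d {} lam" "1 \<le> d"
  shows "0 \<le> lam"
proof -
  obtain f where f: "face_sum {} 1 f = 0" "face_sum {} 1 (\<lambda>t. (f t)\<^sup>2) > 0"
    using exists_centred[of 1] assms(2) by blast
  have "0 \<le> real d * lam * face_sum {} 1 (\<lambda>t. (f t)\<^sup>2)"
    using link_quadratic_form_bound[OF assms(1) _ _ _ f(1)] assms(2) wt_empty by simp
  then show ?thesis using f(2) assms(2) by (simp add: zero_le_mult_iff)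
qed

text \<open>The expander hypothesis speaks of faces only; for any other \<open>r\<close> the weight
  is 0 and all sums over its link vanish.\<close>

lemma expander_bounded:
  assumes exp: "two_sided_link_expander F w d lam" and "1 \<le> a" "1 \<le> b" "a + b \<le> d + 1"
  shows "pair_bounded lam {} a b"
proof (rule pair_bounded_if_edges_bounded)
  have spec: "link_spectral_ok F w d r lam" if "wt r > 0" "card r + 2 \<le> d + 1" for r
    using exp that unfolding two_sided_link_expander_def wt_pos_iff by auto
  then show lam: "0 \<le> lam" using expander_nonneg wt_empty assms by simp
  show "pair_bounded lam r 1 1" if "finite r" "card r + 2 \<le> d + 1" for r
  proof (cases "wt r > 0")
    case True
    then show ?thesis using edges_bounded[OF spec] that lam by blast
  next
    case False
    then show ?thesis using wt_nonneg[of r] by (intro pair_bounded_degenerate) simp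
  qed
qed (use assms in auto)

section \<open>The complement walk in terms of the pair form\<close>

lemma level_eq: "level F w l = {s \<in> k_subsets (\<Union>F) (l + 1). wt s > 0}"
  by (auto simp: level_def k_subsets_def wt_pos_iff faces_def)

text \<open>Outside the complex \<open>wt\<close> is 0, so one formula covers unions that are faces
  and unions that are not.\<close>

lemma complement_edge_eq:
  assumes "s \<in> k_subsets (\<Union>F) (l1 + 1)" "t \<in> k_subsets (\<Union>F) (l2 + 1)"
  shows "complement_edge F w d l1 l2 s t = (if s \<inter> t = {} then wt (s \<union> t) /
     (real ((d + 1) choose (l1 + l2 + 2)) * real ((l1 + l2 + 2) choose (l1 + 1))) else 0)"
proof (cases "s \<inter> t = {}")
  case True
  have "finite s" "finite t" "card s = l1 + 1" "card t = l2 + 1"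
    using assms by (auto simp: k_subsets_def intro: card_ge_0_finite)
  then have c: "card (s \<union> t) = l1 + l2 + 2" using True by (simp add: card_Un_disjoint)
  have "wt (s \<union> t) = 0" if "s \<union> t \<notin> faces F w"
    using that wt_nonneg[of "s \<union> t"] wt_pos_iff[of "s \<union> t"] by simp
  then show ?thesis using True assms c
    by (auto simp: complement_edge_def level_def k_subsets_def meas_def wt_def)
qed (simp add: complement_edge_def)

text \<open>The walk sums over faces of positive weight, the pair form over all vertex subsets; the
  terms in which they differ are 0.\<close>

lemma sum_disjoint_level:
  assumes "t \<subseteq> \<Union>F"
  shows "(\<Sum>s\<in>level F w l. (if s \<inter> t = {} then wt (s \<union> t) / Z else 0) * k s)
    = (\<Sum>s\<in>k_subsets (\<Union>F - t) (l + 1). wt (s \<union> t) * k s) / Z"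
proof -
  have zero: "wt (s \<union> t) = 0" if "\<not> 0 < wt s" for s
    using that wt_nonneg[of s] wt_eq_0_mono[of s "s \<union> t"] by simp
  have "(\<Sum>s\<in>level F w l. (if s \<inter> t = {} then wt (s \<union> t) / Z else 0) * k s)
      = (\<Sum>s\<in>k_subsets (\<Union>F - t) (l + 1). wt (s \<union> t) / Z * k s)"
  proof (rule sum.mono_neutral_cong)
    show "wt (s \<union> t) / Z * k s = 0" if "s \<in> k_subsets (\<Union>F - t) (l + 1) - level F w l" for s
    proof -
      have "\<not> 0 < wt s" using that by (auto simp: level_eq k_subsets_def)
      then show ?thesis by (simp add: zero)
    qed
  qed (auto simp: level_eq k_subsets_def[of "\<Union>F - t"] simp: k_subsets_def)
  then show ?thesis by (simp add: sum_divide_distrib)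
qed

lemma sum_level_eq_A: "(\<Sum>t\<in>level F w l. wt t * k t) = face_sum {} (l + 1) k"
  unfolding face_sum_eq_sum level_eq
  by (rule sum.mono_neutral_cong_left) (use wt_nonneg in \<open>auto simp: less_le\<close>)

text \<open>The marginals of the walk are \<open>\<alpha> / Z\<close> and \<open>\<beta> / Z\<close>
  times \<open>wt\<close>, with the very binomials that weight the norms in
  \<open>pair_bounded\<close>.\<close>

lemma bip_lambda_le:
  assumes le: "l1 + l2 + 1 \<le> d" and bnd: "pair_bounded lam {} (l1 + 1) (l2 + 1)"
  shows "bip_lambda (level F w l1) (level F w l2) (complement_edge F w d l1 l2)
           \<le> real (l1 + 1) * real (l2 + 1) * lam"
proof -
  let ?L = "level F w l1" and ?R = "level F w l2" and ?E = "complement_edge F w d l1 l2"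
  define a where "a = l1 + 1"
  define b where "b = l2 + 1"
  define Z where "Z = real ((d + 1) choose (l1 + l2 + 2)) * real ((l1 + l2 + 2) choose (l1 + 1))"
  define \<alpha> where "\<alpha> = real ((d + 1 - b) choose a)"
  define \<beta> where "\<beta> = real ((d + 1 - a) choose b)"
  have Z: "Z > 0" and \<alpha>: "\<alpha> > 0" and \<beta>: "\<beta> > 0"
    unfolding Z_def \<alpha>_def \<beta>_def a_def b_def
    using le by (auto simp only: of_nat_0_less_iff zero_less_binomial_iff intro!: mult_pos_pos)
  have E: "?E s t = (if s \<inter> t = {} then wt (s \<union> t) / Z else 0)" if "s \<in> ?L" "t \<in> ?R" for s t
    unfolding Z_def by (rule complement_edge_eq) (use that in \<open>auto simp: level_eq\<close>)
  have sub: "t \<subseteq> \<Union>F" if "t \<in> level F w l" for t l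
    using that by (auto simp: level_eq k_subsets_def)
  have sumL: "(\<Sum>s\<in>?L. ?E s t * k s) = (\<Sum>s\<in>k_subsets (\<Union>F - t) a. wt (s \<union> t) * k s) / Z"
    if t: "t \<in> ?R" for t k
    unfolding a_def sum_disjoint_level[OF sub[OF t], symmetric]
    by (intro sum.cong refl) (simp only: E t)
  have sumR: "(\<Sum>t\<in>?R. ?E s t * k t) = (\<Sum>t\<in>k_subsets (\<Union>F - s) b. wt (t \<union> s) * k t) / Z"
    if s: "s \<in> ?L" for s k
    unfolding b_def sum_disjoint_level[OF sub[OF s], symmetric]
    by (intro sum.cong refl) (simp only: E s Int_commute Un_commute)
  have mR: "margR ?L ?R ?E t = \<alpha> / Z * wt t" if t: "t \<in> ?R" for t
  proof -
    have "margR ?L ?R ?E t = face_sum t a (\<lambda>_. 1) / Z"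
      using sumL[OF t, of "\<lambda>_. 1"] by (simp add: margR_def face_sum_eq_sum Un_commute)
    moreover have "card t = b" using t by (simp add: level_eq k_subsets_def b_def)
    ultimately show ?thesis by (simp add: face_sum_const \<alpha>_def)
  qed
  have mL: "margL ?L ?R ?E s = \<beta> / Z * wt s" if s: "s \<in> ?L" for s
  proof -
    have "margL ?L ?R ?E s = face_sum s b (\<lambda>_. 1) / Z"
      using sumR[OF s, of "\<lambda>_. 1"] by (simp add: margL_def face_sum_eq_sum Un_commute)
    moreover have "card s = a" using s by (simp add: level_eq k_subsets_def a_def)
    ultimately show ?thesis by (simp add: face_sum_const \<beta>_def)
  qed
  have sum_mR: "(\<Sum>t\<in>?R. margR ?L ?R ?E t * k t) = \<alpha> / Z * face_sum {} b k" for k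
    unfolding b_def sum_level_eq_A[symmetric] sum_distrib_left
    by (intro sum.cong) (simp_all add: mR)
  have sum_mL: "(\<Sum>s\<in>?L. margL ?L ?R ?E s * k s) = \<beta> / Z * face_sum {} a k" for k
    unfolding a_def sum_level_eq_A[symmetric] sum_distrib_left
    by (intro sum.cong) (simp_all add: mL)
  have form: "(\<Sum>s\<in>?L. margL ?L ?R ?E s * bip_op ?L ?R ?E f s * g s) = pair_sum {} a b g f / Z" for f g
  proof -
    have "(\<Sum>s\<in>?L. margL ?L ?R ?E s * bip_op ?L ?R ?E f s * g s) = (\<Sum>s\<in>?L. \<Sum>t\<in>?R. ?E s t * f t * g s)"
    proof (intro sum.cong refl)
      fix s assume s: "s \<in> ?L"
      then have "wt s > 0" by (simp add: level_eq)
      then have "margL ?L ?R ?E s \<noteq> 0" using mL[OF s] Z \<beta> by simp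
      then show "margL ?L ?R ?E s * bip_op ?L ?R ?E f s * g s = (\<Sum>t\<in>?R. ?E s t * f t * g s)"
        by (simp add: bip_op_def sum_distrib_right)
    qed
    also have "\<dots> = (\<Sum>t\<in>?R. (\<Sum>s\<in>?L. ?E s t * g s) * f t)"
      by (subst sum.swap) (simp add: sum_distrib_left mult_ac)
    also have "\<dots> = (\<Sum>t\<in>?R. (\<Sum>s\<in>k_subsets (\<Union>F - t) a. wt (s \<union> t) * g s) / Z * f t)"
      by (intro sum.cong refl) (simp add: sumL)
    also have "\<dots> = (\<Sum>t\<in>k_subsets (\<Union>F) b. (\<Sum>s\<in>k_subsets (\<Union>F - t) a. wt (s \<union> t) * g s) / Z * f t)"
    proof (rule sum.mono_neutral_left)
      show "\<forall>t\<in>k_subsets (\<Union>F) b - ?R. (\<Sum>s\<in>k_subsets (\<Union>F - t) a. wt (s \<union> t) * g s) / Z * f t = 0"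
      proof
        fix t assume "t \<in> k_subsets (\<Union>F) b - ?R"
        then have "wt t = 0" using wt_nonneg[of t] by (auto simp: level_eq b_def less_le)
        then have "wt (s \<union> t) = 0" for s by (rule wt_eq_0_mono) auto
        then show "(\<Sum>s\<in>k_subsets (\<Union>F - t) a. wt (s \<union> t) * g s) / Z * f t = 0" by simp
      qed
    qed (auto simp: level_eq b_def)
    also have "\<dots> = pair_sum {} a b g f / Z"
      by (simp add: pair_sum_eq_sum sum_divide_distrib sum_distrib_right)
    finally show ?thesis .
  qed
  have scale: "\<exists>c. \<kappa> * face_sum {} k (\<lambda>t. (c * f t)\<^sup>2) = 1" if "\<kappa> > 0" "face_sum {} k (\<lambda>t. (f t)\<^sup>2) > 0" for \<kappa> k f
  proof -
    let ?x = "\<kappa> * face_sum {} k (\<lambda>t. (f t)\<^sup>2)"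
    have "?x > 0" using that by simp
    moreover have "\<kappa> * face_sum {} k (\<lambda>t. (1 / sqrt ?x * f t)\<^sup>2) = (1 / sqrt ?x)\<^sup>2 * ?x"
      by (simp only: power_mult_distrib face_sum_mult) (simp only: mult_ac)
    moreover have "(1 / sqrt y)\<^sup>2 * y = 1" if "y > 0" for y :: real
      using that by (simp add: power_divide)
    ultimately show ?thesis by metis
  qed
  let ?S = "{(\<Sum>v\<in>?L. margL ?L ?R ?E v * bip_op ?L ?R ?E f v * g v) | f g.
      sqrt (\<Sum>x\<in>?R. margR ?L ?R ?E x * (f x)\<^sup>2) = 1
    \<and> sqrt (\<Sum>v\<in>?L. margL ?L ?R ?E v * (g v)\<^sup>2) = 1
    \<and> (\<Sum>x\<in>?R. margR ?L ?R ?E x * f x) = 0}"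
  have S: "?S = {pair_sum {} a b g f / Z | f g. \<alpha> / Z * face_sum {} b (\<lambda>t. (f t)\<^sup>2) = 1
      \<and> \<beta> / Z * face_sum {} a (\<lambda>s. (g s)\<^sup>2) = 1 \<and> face_sum {} b f = 0}"
    unfolding form sum_mR sum_mL using \<alpha> Z by simp
  have "Sup ?S \<le> real a * real b * lam"
  proof (rule cSup_least)
    \<comment> \<open>Bounding \<open>Sup\<close> requires a feasible pair: a rescaled mean-zero
      function and a rescaled constant.\<close>
    obtain f where f: "face_sum {} b f = 0" "face_sum {} b (\<lambda>t. (f t)\<^sup>2) > 0"
      using exists_centred[of b] le by (auto simp: b_def)
    have "\<alpha> / Z > 0" "\<beta> / Z > 0" using \<alpha> \<beta> Z by auto
    moreover have "(d + 1) choose a > 0"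
      unfolding zero_less_binomial_iff a_def using le by simp
    then have "face_sum {} a (\<lambda>_. 1\<^sup>2) > 0"
      by (simp add: face_sum_const wt_empty del: binomial_Suc_Suc)
    ultimately obtain c e where c: "\<alpha> / Z * face_sum {} b (\<lambda>t. (c * f t)\<^sup>2) = 1"
      and e: "\<beta> / Z * face_sum {} a (\<lambda>s. (e * 1)\<^sup>2) = 1"
      using scale[of "\<alpha> / Z" b f] scale[of "\<beta> / Z" a "\<lambda>_. 1"] f(2) by blast
    have "face_sum {} b (\<lambda>t. c * f t) = 0" by (simp add: face_sum_mult f(1))
    with c e have "pair_sum {} a b (\<lambda>_. e * 1) (\<lambda>t. c * f t) / Z \<in> ?S"
      unfolding S mem_Collect_eq by (intro exI conjI) (rule refl, assumption+)
    then show "?S \<noteq> {}" by blast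
  next
    fix x assume "x \<in> ?S"
    then obtain f g where x: "x = pair_sum {} a b g f / Z" and f: "\<alpha> / Z * face_sum {} b (\<lambda>t. (f t)\<^sup>2) = 1"
      and g: "\<beta> / Z * face_sum {} a (\<lambda>s. (g s)\<^sup>2) = 1" and f0: "face_sum {} b f = 0"
      unfolding S by blast
    \<comment> \<open>For unit vectors both weighted norms equal \<open>Z\<close>, and
      \<open>Z + Z\<close> absorbs the factor 2 of \<open>pair_bounded\<close>.\<close>
    have "\<alpha> * face_sum {} b (\<lambda>t. (f t)\<^sup>2) = Z" "\<beta> * face_sum {} a (\<lambda>s. (g s)\<^sup>2) = Z"
      using f g Z by (auto simp: field_simps)
    then have "2 * \<bar>pair_sum {} a b g f\<bar> \<le> real a * real b * lam * (Z + Z)"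
      using pair_boundedD[OF bnd[folded a_def b_def] f0, of g] by (simp add: \<alpha>_def \<beta>_def)
    then have "pair_sum {} a b g f \<le> real a * real b * lam * Z" by (simp add: abs_if split: if_splits)
    then show "x \<le> real a * real b * lam" using Z by (simp add: x divide_le_eq)
  qed
  then show ?thesis unfolding bip_lambda_def a_def b_def .
qed

end

theorem theorem7p1:
  fixes F :: "'v set set" and w :: "'v set \<Rightarrow> real" and d l1 l2 :: nat and lam :: real
  assumes "two_sided_link_expander F w d lam"
    and "l1 + l2 + 1 \<le> d"
  shows "bip_lambda (level F w l1) (level F w l2) (complement_edge F w d l1 l2)
           \<le> real (l1 + 1) * real (l2 + 1) * lam"
proof -
  interpret weighted F w d
    using assms(1) by unfold_locales (simp add: two_sided_link_expander_def)
  show ?thesis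
    using assms by (intro bip_lambda_le expander_bounded) auto
qed

end
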